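(* Let $I(z,k_+,k_-)$ be the imaging function defined in the context. Then for every $z\in\mathbb{R}^2$, $$I(z,k_+,k_-)=I_1(z,k_+,k_-)+I_2(z,k_+,k_-),$$ where $$I_1(z,k_+,k_-)=\int_{\mathbb{S}^+_{\theta_c}}|v^\infty(\hat x,z,k_+,k_-)|^2\,ds(\hat x),\qquad I_2(z,k_+,k_-)=\int_{\mathbb{S}^+_{\theta_c}}|w^\infty(\hat x,z,k_+,k_-)|^2\,ds(\hat x).$$ Here $$v^\infty(\hat x,z,k_+,k_-):=\int_{\mathbb{S}^-_{\theta_c}}u^\infty(\hat x,d,k_+,k_-)\,T(\theta_d)\,e^{-ik_-z\cdot d^t}\,ds(d),$$ $$w^\infty(\hat x,z,k_+,k_-):=\int_{\mathbb{S}^-_{\theta_c}}u^\infty(\hat x,d,k_+,k_-)\,T(\theta_d)\,e^{ik_-z\cdot d^t}\,ds(d)$$ are the far-field patterns of the solutions $u^s$ of the scattering problem $$\begin{cases}\Delta u^s+k^2u^s=0 & \text{in }\mathbb{R}^2\setminus(\overline D\cup\Gamma),\\ [u^s]=0,\ \ [\partial u^s/\partial\nu]=0 & \text{on }\Gamma,\\ u^s=f_z & \text{on }\partial D,\\ \displaystyle\lim_{r\to\infty}\int_{\mathbb{S}^1_r}\left|\frac{\partial u^s}{\partial r}-iku^s\right|^2ds=0, & r=|x|,\end{cases}$$ with the boundary data $$f_z(x)=-\int_{\mathbb{S}^-_{\theta_c}}T^2(\theta_d)\,e^{ik_-(x-z)\cdot d^t}\,ds(d),\quad x\in\partial D,$$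 for $v^\infty$, and $$f_z(x)=-\int_{\mathbb{S}^-_{\theta_c}}T^2(\theta_d)\,e^{ik_-(x+z)\cdot d^t}\,ds(d),\quad x\in\partial D,$$ for $w^\infty$, respectively.
   Context: Setting. Let $\mathbb{R}^2_\pm=\{(x_1,x_2)\in\mathbb{R}^2:\pm x_2>0\}$ and $\Gamma=\{x_2=0\}$. Let $k_+,k_->0$ with $k_+\neq k_-$ be the wave numbers in $\mathbb{R}^2_+$ and $\mathbb{R}^2_-$, and set $k=k_\pm$ in $\mathbb{R}^2_\pm$. The obstacle $D$ is a bounded open set with connected complement, possibly consisting of finitely many disjoint components, fully embedded in the lower half-space $\mathbb{R}^2_-$ (so $\overline D\subset\mathbb{R}^2_-$). Its boundary is regular enough that the scattering problem below is well-posed. $[\cdot]$ denotes the jump across $\Gamma$, $\nu$ is the unit normal on $\Gamma$ directed into $\mathbb{R}^2_+$, and $\mathbb{S}^1_r=\{x\in\mathbb{R}^2:|x|=r\}$. The symbol $ds$ denotes arc-length measure. Angles and coefficients. Let $\theta_c=\arccos(k_-/k_+)$ if $k_+>k_-$ and $\theta_c=0$ if $k_+<k_-$. Define $$\mathbb{S}^-_{\theta_c}=\{(\cos\theta,\sin\theta):\theta\in[\pi+\theta_c,2\pi-\theta_c]\},\qquad \mathbb{S}^+_{\theta_c}=\{(\cos\theta,\sin\theta):\theta\in[\theta_c,\pi-\theta_c]\}.$$ For $d=(\cos\theta_d,\sin\theta_d)\in\mathbb{S}^-_{\theta_c}$ let $\theta_d^t\in[\pi,2\pi]$ be determined by $k_+\cos\theta_d=k_-\cos\theta_d^t$,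 and put $$d^t=(\cos\theta_d^t,\sin\theta_d^t),\quad d^r=(\cos\theta_d,-\sin\theta_d),\quad T(\theta_d)=\frac{2k_+\sin\theta_d}{k_+\sin\theta_d+k_-\sin\theta_d^t},\quad R(\theta_d)=\frac{k_+\sin\theta_d-k_-\sin\theta_d^t}{k_+\sin\theta_d+k_-\sin\theta_d^t}.$$ Scattering problem. For $d\in\mathbb{S}^-_{\theta_c}$ and the incident plane wave $e^{ik_+x\cdot d}$, the background field is $$u^0(x,d,k_+,k_-)=\begin{cases}e^{ik_+x\cdot d}+R(\theta_d)e^{ik_+x\cdot d^r}, & x\in\mathbb{R}^2_+,\\ T(\theta_d)e^{ik_-x\cdot d^t}, & x\in\mathbb{R}^2_-.\end{cases}$$ The scattered field $u^s(x,d,k_+,k_-)$ is the unique solution of $$\begin{cases}\Delta u^s+k^2u^s=0 & \text{in }\mathbb{R}^2\setminus(\overline D\cup\Gamma),\\ [u^s]=0,\ [\partial u^s/\partial\nu]=0 & \text{on }\Gamma,\\ u^s=f & \text{on }\partial D,\\ \lim_{r\to\infty}\int_{\mathbb{S}^1_r}|\partial u^s/\partial r-iku^s|^2ds=0\end{cases}$$ with $f=-u^0|_{\partial D}$. This boundary value problem is well-posed. Its solution satisfies, as $|x|\to\infty$, $$u^s(x)=\frac{e^{ik_+|x|}}{\sqrt{|x|}}u^\infty(\hat x)+o\left(\frac1{\sqrt{|x|}}\right)$$ for all directions $\hat x=x/|x|$ in the open upper unit half-circle. The function $u^\infty$ is called the far-field pattern of $u^s$. The far-field pattern of $u^s(\cdot,d,k_+,k_-)$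 is denoted $u^\infty(\hat x,d,k_+,k_-)$. For two directions $d_1,d_2\in\mathbb{S}^-_{\theta_c}$, the far-field pattern for the incident field $e^{ik_+x\cdot d_1}+e^{ik_+x\cdot d_2}$ is $$u^\infty(\hat x,d_1,d_2,k_+,k_-)=u^\infty(\hat x,d_1,k_+,k_-)+u^\infty(\hat x,d_2,k_+,k_-).$$ Imaging function. For $z\in\mathbb{R}^2$, $$\begin{aligned}I(z,k_+,k_-)=&\int_{\mathbb{S}^+_{\theta_c}}\int_{\mathbb{S}^-_{\theta_c}}\int_{\mathbb{S}^-_{\theta_c}}|u^\infty(\hat x,d_1,d_2,k_+,k_-)|^2\,T(\theta_{d_1})e^{-ik_-z\cdot d_1^t}\,T(\theta_{d_2})e^{ik_-z\cdot d_2^t}\,ds(d_1)ds(d_2)ds(\hat x)\\&-\int_{\mathbb{S}^-_{\theta_c}}T(\theta_d)e^{ik_-z\cdot d^t}ds(d)\int_{\mathbb{S}^+_{\theta_c}}\int_{\mathbb{S}^-_{\theta_c}}|u^\infty(\hat x,d,k_+,k_-)|^2\,T(\theta_d)e^{-ik_-z\cdot d^t}ds(d)ds(\hat x)\\&-\int_{\mathbb{S}^-_{\theta_c}}T(\theta_d)e^{-ik_-z\cdot d^t}ds(d)\int_{\mathbb{S}^+_{\theta_c}}\int_{\mathbb{S}^-_{\theta_c}}|u^\infty(\hat x,d,k_+,k_-)|^2\,T(\theta_d)e^{ik_-z\cdot d^t}ds(d)ds(\hat x).\end{aligned}$$ *)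

theory Defs
  imports "HOL-Analysis.Analysis" "HOL-Library.Landau_Symbols"
begin

section \<open>Geometry\<close>

definition upper :: "(real ^ 2) set" where
  "upper = {x. x $ 2 > 0}"

definition lower :: "(real ^ 2) set" where
  "lower = {x. x $ 2 < 0}"

definition interface :: "(real ^ 2) set" where
  "interface = {x. x $ 2 = 0}"

definition wave_number :: "real \<Rightarrow> real \<Rightarrow> real ^ 2 \<Rightarrow> real" where
  "wave_number kp km x = (if x \<in> upper then kp else km)"

definition dir :: "real \<Rightarrow> real ^ 2" where
  "dir \<theta> = vector [cos \<theta>, sin \<theta>]"

section \<open>Angles and transmission coefficients\<close>

text \<open>Unit directions are represented by their angle: \<open>\<theta>\<close> stands for \<open>d = dir \<theta>\<close>.
  In this parametrization the arc-length measure on an arc of the unit circle is Lebesgue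
  measure on the corresponding interval of angles.\<close>

definition theta_c :: "real \<Rightarrow> real \<Rightarrow> real" where
  "theta_c kp km = (if kp > km then arccos (km / kp) else 0)"

definition arc_minus :: "real \<Rightarrow> real \<Rightarrow> real set" where
  "arc_minus kp km = {pi + theta_c kp km .. 2 * pi - theta_c kp km}"

definition arc_plus :: "real \<Rightarrow> real \<Rightarrow> real set" where
  "arc_plus kp km = {theta_c kp km .. pi - theta_c kp km}"

definition theta_t :: "real \<Rightarrow> real \<Rightarrow> real \<Rightarrow> real" where
  "theta_t kp km \<theta> = (THE t. t \<in> {pi .. 2 * pi} \<and> kp * cos \<theta> = km * cos t)"

definition dir_t :: "real \<Rightarrow> real \<Rightarrow> real \<Rightarrow> real ^ 2" where
  "dir_t kp km \<theta> = dir (theta_t kp km \<theta>)"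

definition dir_r :: "real \<Rightarrow> real ^ 2" where
  "dir_r \<theta> = vector [cos \<theta>, - sin \<theta>]"

definition T_coeff :: "real \<Rightarrow> real \<Rightarrow> real \<Rightarrow> real" where
  "T_coeff kp km \<theta> =
     2 * kp * sin \<theta> / (kp * sin \<theta> + km * sin (theta_t kp km \<theta>))"

definition R_coeff :: "real \<Rightarrow> real \<Rightarrow> real \<Rightarrow> real" where
  "R_coeff kp km \<theta> =
     (kp * sin \<theta> - km * sin (theta_t kp km \<theta>)) / (kp * sin \<theta> + km * sin (theta_t kp km \<theta>))"

definition plane_wave :: "real \<Rightarrow> real ^ 2 \<Rightarrow> real ^ 2 \<Rightarrow> complex" where
  "plane_wave k d x = exp (\<i> * complex_of_real (k * (x \<bullet> d)))"

text \<open>On the interface the two formulas agree, because \<open>1 + R = T\<close>.\<close>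

definition background_field :: "real \<Rightarrow> real \<Rightarrow> real \<Rightarrow> real ^ 2 \<Rightarrow> complex" where
  "background_field kp km \<theta> x =
     (if x \<in> upper
      then plane_wave kp (dir \<theta>) x + of_real (R_coeff kp km \<theta>) * plane_wave kp (dir_r \<theta>) x
      else of_real (T_coeff kp km \<theta>) * plane_wave km (dir_t kp km \<theta>) x)"

section \<open>The scattering problem\<close>

definition partial_deriv :: "2 \<Rightarrow> (real ^ 2 \<Rightarrow> complex) \<Rightarrow> real ^ 2 \<Rightarrow> complex" where
  "partial_deriv i u x = frechet_derivative u (at x) (axis i 1)"

definition radial_deriv :: "(real ^ 2 \<Rightarrow> complex) \<Rightarrow> real ^ 2 \<Rightarrow> complex" where
  "radial_deriv u x = frechet_derivative u (at x) (x /\<^sub>R norm x)"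

definition laplacian :: "(real ^ 2 \<Rightarrow> complex) \<Rightarrow> real ^ 2 \<Rightarrow> complex" where
  "laplacian u x = (\<Sum>i\<in>UNIV. partial_deriv i (partial_deriv i u) x)"

definition C1_on :: "(real ^ 2) set \<Rightarrow> (real ^ 2 \<Rightarrow> complex) \<Rightarrow> bool" where
  "C1_on S u \<longleftrightarrow> (\<forall>x\<in>S. u differentiable (at x)) \<and> (\<forall>i. continuous_on S (partial_deriv i u))"

definition C2_on :: "(real ^ 2) set \<Rightarrow> (real ^ 2 \<Rightarrow> complex) \<Rightarrow> bool" where
  "C2_on S u \<longleftrightarrow> C1_on S u \<and> (\<forall>i. C1_on S (partial_deriv i u))"

text \<open>\<open>[g](x) = 0\<close>: the traces of \<open>g\<close> from above and from below exist and coincide.\<close>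

definition no_jump_at :: "(real ^ 2 \<Rightarrow> complex) \<Rightarrow> real ^ 2 \<Rightarrow> bool" where
  "no_jump_at g x \<longleftrightarrow> (\<exists>l. (g \<longlongrightarrow> l) (at x within upper) \<and> (g \<longlongrightarrow> l) (at x within lower))"

text \<open>On the circle of radius \<open>r\<close> one has \<open>ds = r d\<theta>\<close>. The integrand is nonnegative, so the
  integral is taken with values in \<open>[0, \<infinity>]\<close>; no integrability convention is involved.\<close>

definition radiation_condition :: "real \<Rightarrow> real \<Rightarrow> (real ^ 2 \<Rightarrow> complex) \<Rightarrow> bool" where
  "radiation_condition kp km u \<longleftrightarrow>
     ((\<lambda>r. \<integral>\<^sup>+\<theta>\<in>{0..2 * pi}.
         ennreal (r * (cmod (radial_deriv u (r *\<^sub>R dir \<theta>)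
           - \<i> * of_real (wave_number kp km (r *\<^sub>R dir \<theta>)) * u (r *\<^sub>R dir \<theta>)))\<^sup>2) \<partial>lborel)
       \<longlongrightarrow> 0) at_top"

text \<open>Classical solutions, continuous up to \<open>\<partial>D\<close>. Since \<open>\<nu> = (0, 1)\<close> on the interface,
  the normal derivative is the second partial derivative. Only the values of \<open>u\<close> outside \<open>D\<close>
  and those of \<open>f\<close> on \<open>\<partial>D\<close> matter.\<close>

definition scattering_solution ::
  "(real ^ 2) set \<Rightarrow> real \<Rightarrow> real \<Rightarrow> (real ^ 2 \<Rightarrow> complex) \<Rightarrow> (real ^ 2 \<Rightarrow> complex) \<Rightarrow> bool" where
  "scattering_solution D kp km f u \<longleftrightarrow>
     C2_on (- (closure D \<union> interface)) u \<and>
     continuous_on (- D) u \<and>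
     (\<forall>x \<in> - (closure D \<union> interface).
        laplacian u x + (of_real (wave_number kp km x))\<^sup>2 * u x = 0) \<and>
     (\<forall>x \<in> interface. no_jump_at u x \<and> no_jump_at (partial_deriv 2 u) x) \<and>
     (\<forall>x \<in> frontier D. u x = f x) \<and>
     radiation_condition kp km u"

text \<open>Well-posedness in the sense of Hadamard: existence, uniqueness, and continuous dependence
  of the solution (uniformly on compact sets) on the boundary data (uniformly on \<open>\<partial>D\<close>).\<close>

definition well_posed :: "(real ^ 2) set \<Rightarrow> real \<Rightarrow> real \<Rightarrow> bool" where
  "well_posed D kp km \<longleftrightarrow>
     (\<forall>f. continuous_on (frontier D) f \<longrightarrow> (\<exists>u. scattering_solution D kp km f u)) \<and>
     (\<forall>f u v. scattering_solution D kp km f u \<longrightarrow> scattering_solution D kp km f v \<longrightarrow>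
        (\<forall>x \<in> - D. u x = v x)) \<and>
     (\<forall>F U f u. (\<forall>n::nat. scattering_solution D kp km (F n) (U n)) \<longrightarrow>
        scattering_solution D kp km f u \<longrightarrow>
        uniform_limit (frontier D) F f sequentially \<longrightarrow>
        (\<forall>K. compact K \<longrightarrow> K \<subseteq> - D \<longrightarrow> uniform_limit K U u sequentially))"

text \<open>The solution is determined outside \<open>D\<close> only; its values in \<open>D\<close> are immaterial.\<close>

definition scattered_field ::
  "(real ^ 2) set \<Rightarrow> real \<Rightarrow> real \<Rightarrow> (real ^ 2 \<Rightarrow> complex) \<Rightarrow> real ^ 2 \<Rightarrow> complex" where
  "scattered_field D kp km f = (SOME u. scattering_solution D kp km f u)"

section \<open>Far-field patterns\<close>

text \<open>The expansion is a statement about \<open>|x| \<rightarrow> \<infinity>\<close> with \<open>x\<close> ranging over the upper half-plane,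
  so the remainder is uniform in the direction \<open>x/|x|\<close>.\<close>

definition is_far_field_pattern ::
  "real \<Rightarrow> (real ^ 2 \<Rightarrow> complex) \<Rightarrow> (real ^ 2 \<Rightarrow> complex) \<Rightarrow> bool" where
  "is_far_field_pattern kp u U \<longleftrightarrow>
     (\<lambda>x. u x - exp (\<i> * of_real (kp * norm x)) / of_real (sqrt (norm x)) * U (x /\<^sub>R norm x))
       \<in> o[inf at_infinity (principal upper)](\<lambda>x. of_real (1 / sqrt (norm x)))"

text \<open>The expansion determines the pattern on the open upper unit half-circle; elsewhere it is
  set to \<open>0\<close> (for the integrals below this concerns at most the two end points of an arc).\<close>

definition far_field_pattern :: "real \<Rightarrow> (real ^ 2 \<Rightarrow> complex) \<Rightarrow> real ^ 2 \<Rightarrow> complex" where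
  "far_field_pattern kp u =
     (THE U. is_far_field_pattern kp u U \<and> (\<forall>y. \<not> (norm y = 1 \<and> y \<in> upper) \<longrightarrow> U y = 0))"

definition u_inf :: "(real ^ 2) set \<Rightarrow> real \<Rightarrow> real \<Rightarrow> real ^ 2 \<Rightarrow> real \<Rightarrow> complex" where
  "u_inf D kp km y \<theta> =
     far_field_pattern kp (scattered_field D kp km (\<lambda>x. - background_field kp km \<theta> x)) y"

definition u_inf2 :: "(real ^ 2) set \<Rightarrow> real \<Rightarrow> real \<Rightarrow> real ^ 2 \<Rightarrow> real \<Rightarrow> real \<Rightarrow> complex" where
  "u_inf2 D kp km y \<theta>1 \<theta>2 = u_inf D kp km y \<theta>1 + u_inf D kp km y \<theta>2"

section \<open>The imaging function\<close>

text \<open>\<open>T(\<theta>) exp(i k\<^sub>- z \<cdot> d\<^sup>t)\<close>; the factor with the opposite sign in the exponent is obtained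
  by replacing \<open>z\<close> with \<open>-z\<close>.\<close>

definition transmitted :: "real \<Rightarrow> real \<Rightarrow> real ^ 2 \<Rightarrow> real \<Rightarrow> complex" where
  "transmitted kp km z \<theta> = of_real (T_coeff kp km \<theta>) * plane_wave km (dir_t kp km \<theta>) z"

definition imaging_function :: "(real ^ 2) set \<Rightarrow> real \<Rightarrow> real \<Rightarrow> real ^ 2 \<Rightarrow> complex" where
  "imaging_function D kp km z =
     (LINT \<phi>:arc_plus kp km|lborel. LINT \<theta>2:arc_minus kp km|lborel. LINT \<theta>1:arc_minus kp km|lborel.
        of_real ((cmod (u_inf2 D kp km (dir \<phi>) \<theta>1 \<theta>2))\<^sup>2)
          * transmitted kp km (- z) \<theta>1 * transmitted kp km z \<theta>2)
     - (LINT \<theta>:arc_minus kp km|lborel. transmitted kp km z \<theta>)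
       * (LINT \<phi>:arc_plus kp km|lborel. LINT \<theta>:arc_minus kp km|lborel.
            of_real ((cmod (u_inf D kp km (dir \<phi>) \<theta>))\<^sup>2) * transmitted kp km (- z) \<theta>)
     - (LINT \<theta>:arc_minus kp km|lborel. transmitted kp km (- z) \<theta>)
       * (LINT \<phi>:arc_plus kp km|lborel. LINT \<theta>:arc_minus kp km|lborel.
            of_real ((cmod (u_inf D kp km (dir \<phi>) \<theta>))\<^sup>2) * transmitted kp km z \<theta>)"

definition v_inf :: "(real ^ 2) set \<Rightarrow> real \<Rightarrow> real \<Rightarrow> real ^ 2 \<Rightarrow> real ^ 2 \<Rightarrow> complex" where
  "v_inf D kp km z y =
     (LINT \<theta>:arc_minus kp km|lborel. u_inf D kp km y \<theta> * transmitted kp km (- z) \<theta>)"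

definition w_inf :: "(real ^ 2) set \<Rightarrow> real \<Rightarrow> real \<Rightarrow> real ^ 2 \<Rightarrow> real ^ 2 \<Rightarrow> complex" where
  "w_inf D kp km z y =
     (LINT \<theta>:arc_minus kp km|lborel. u_inf D kp km y \<theta> * transmitted kp km z \<theta>)"

definition I1 :: "(real ^ 2) set \<Rightarrow> real \<Rightarrow> real \<Rightarrow> real ^ 2 \<Rightarrow> real" where
  "I1 D kp km z = (LINT \<phi>:arc_plus kp km|lborel. (cmod (v_inf D kp km z (dir \<phi>)))\<^sup>2)"

definition I2 :: "(real ^ 2) set \<Rightarrow> real \<Rightarrow> real \<Rightarrow> real ^ 2 \<Rightarrow> real" where
  "I2 D kp km z = (LINT \<phi>:arc_plus kp km|lborel. (cmod (w_inf D kp km z (dir \<phi>)))\<^sup>2)"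

definition boundary_data_v :: "real \<Rightarrow> real \<Rightarrow> real ^ 2 \<Rightarrow> real ^ 2 \<Rightarrow> complex" where
  "boundary_data_v kp km z x =
     - (LINT \<theta>:arc_minus kp km|lborel.
          of_real ((T_coeff kp km \<theta>)\<^sup>2) * plane_wave km (dir_t kp km \<theta>) (x - z))"

definition boundary_data_w :: "real \<Rightarrow> real \<Rightarrow> real ^ 2 \<Rightarrow> real ^ 2 \<Rightarrow> complex" where
  "boundary_data_w kp km z x =
     - (LINT \<theta>:arc_minus kp km|lborel.
          of_real ((T_coeff kp km \<theta>)\<^sup>2) * plane_wave km (dir_t kp km \<theta>) (x + z))"

end

theory Submission
  imports Defs
begin

text \<open>
Two things have to be shown: an algebraic identity for intensities, and the fact that the weighted
superpositions \<open>v_inf\<close> and \<open>w_inf\<close> of far-field patterns are themselves far-field patterns.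

The identity rests on \<open>|a + b|\<^sup>2 = |a|\<^sup>2 + |b|\<^sup>2 + a (cnj b) + (cnj a) b\<close>, applied to
\<open>a = u_inf y \<theta>1\<close> and \<open>b = u_inf y \<theta>2\<close>. The weight \<open>transmitted (-z)\<close> is the complex
conjugate of \<open>transmitted z\<close>, so after integration over both angles the two mixed terms are the
squared moduli of \<open>v_inf\<close> and \<open>w_inf\<close>, and the two pure terms are exactly the products that
the imaging function subtracts (\<open>four_intensity_identity\<close>). Splitting the outer integral over the
observation angle requires each of the four terms to be integrable there; this follows once
\<open>u_inf\<close> is bounded and jointly continuous in observation and incidence angle.

Both this regularity and the second claim come from one functional-analytic fact. Well-posedness
controls a solution only on compact sets, whereas the far-field pattern is a limit at infinity.
However, for a fixed direction \<open>y\<close> the pattern is the pointwise limit of the functionals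
\<open>F \<mapsto> sqrt n exp (-i k n) u\<^sub>F (n y)\<close>, where \<open>u\<^sub>F\<close> is the solution with boundary data \<open>F\<close>.
Each of them is linear, because the scattering problem is linear with unique solutions, and
continuous in \<open>F\<close>, because \<open>{n y}\<close> is compact. By the Banach-Steinhaus theorem the limit is again
a bounded functional (\<open>bounded_linear_pattern\<close>). A second application of that theorem, over all
directions \<open>y\<close>, makes the bound uniform (\<open>pattern_uniformly_bounded\<close>); it applies because the
remainder in the far-field expansion is uniform in \<open>y\<close>, so that each single pattern is bounded.

The incident waves, restricted to the boundary of the obstacle, form a continuous curve in the
Banach space of boundary data: the denominator of the transmission coefficient does not vanish, and
the angle of refraction depends continuously on the angle of incidence. A bounded functional
commutes with the integral of a continuous curve. Hence the solution whose data is the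
superposition of the incident waves has the superposed pattern (\<open>superposition\<close>), and
composing the curve with the uniformly bounded functionals gives the joint continuity
(\<open>pattern_jointly_continuous\<close>).

Boundary data are represented by bounded continuous functions on the whole plane, extended from a
box around the obstacle; only their values on the boundary of the obstacle enter the solution.
\<close>

section \<open>The Banach-Steinhaus theorem, and curves of continuous functions\<close>

instance bcontfun :: (metric_space, banach) banach ..

text \<open>The Banach-Steinhaus theorem. By Baire's theorem one of the closed sets
\<open>{x. \<forall>i\<in>I. norm (L i x) \<le> n}\<close> contains a ball, and linearity carries the bound on
this ball over to the whole space.\<close>

lemma uniform_boundedness:
  fixes L :: "'i \<Rightarrow> 'a::banach \<Rightarrow> 'b::real_normed_vector"
  assumes lin: "\<And>i. i \<in> I \<Longrightarrow> linear (L i)"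
    and cont: "\<And>i. i \<in> I \<Longrightarrow> continuous_on UNIV (L i)"
    and bdd: "\<And>x. \<exists>M. \<forall>i\<in>I. norm (L i x) \<le> M"
  shows "\<exists>C>0. \<forall>i\<in>I. \<forall>x. norm (L i x) \<le> C * norm x"
proof -
  define S where "S n = {x. \<forall>i\<in>I. norm (L i x) \<le> real n}" for n :: nat
  have closed_S: "closed (S n)" for n
  proof -
    have "S n = (\<Inter>i\<in>I. {x. norm (L i x) \<le> real n})"
      by (auto simp: S_def)
    moreover have "closed {x. norm (L i x) \<le> real n}" if "i \<in> I" for i
      by (intro closed_Collect_le continuous_intros cont that)
    ultimately show ?thesis
      by auto
  qed
  have cover: "(\<Union>n. S n) = UNIV"
  proof -
    have "\<exists>n. x \<in> S n" for x
    proof -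
      obtain M where "\<forall>i\<in>I. norm (L i x) \<le> M"
        using bdd by blast
      moreover obtain n :: nat where "M \<le> real n"
        using real_arch_simple by blast
      ultimately show ?thesis
        unfolding S_def mem_Collect_eq by (meson order_trans)
    qed
    then show ?thesis
      by auto
  qed
  have "\<exists>n. interior (S n) \<noteq> {}"
  proof (rule ccontr)
    assume none: "\<not> (\<exists>n. interior (S n) \<noteq> {})"
    have "Met_TC.mtopology interior_of \<Union>(range S) = ({}::'a set)"
      by (rule Met_TC.metric_Baire_category_alt)
        (use none closed_S in \<open>auto simp: complete_UNIV mcomplete_iff_complete\<close>)
    then show False
      using cover by simp
  qed
  then obtain n x0 where "x0 \<in> interior (S n)"
    by blast
  then obtain e where e: "e > 0" "cball x0 e \<subseteq> S n"
    by (meson mem_interior_cball)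
  \<comment> \<open>The summand \<open>1\<close> keeps the constant positive when \<open>n = 0\<close>.\<close>
  have "norm (L i x) \<le> (2 * real n + 1) / e * norm x" if i: "i \<in> I" for i x
  proof (cases "x = 0")
    case True
    then show ?thesis
      using linear_0[OF lin[OF i]] by simp
  next
    case False
    \<comment> \<open>\<open>c\<close> rescales \<open>x\<close> to length \<open>e\<close>, so that \<open>x0 + c x\<close> lies on the sphere around \<open>x0\<close>.\<close>
    define c where "c = e / norm x"
    have c: "c > 0"
      using False e by (simp add: c_def)
    have "x0 + c *\<^sub>R x \<in> S n" "x0 \<in> S n"
      using e c False by (auto simp: c_def dist_norm intro!: subsetD[OF e(2)])
    then have "norm (L i (x0 + c *\<^sub>R x)) \<le> n" "norm (L i x0) \<le> n"
      using i by (auto simp: S_def)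
    moreover have "c *\<^sub>R L i x = L i (x0 + c *\<^sub>R x) - L i x0"
      by (simp add: linear_add[OF lin[OF i]] linear_scale[OF lin[OF i]])
    ultimately have "norm (c *\<^sub>R L i x) \<le> 2 * real n"
      by (smt (verit) norm_triangle_ineq4)
    then have "e * norm (L i x) \<le> 2 * real n * norm x"
      using c False by (simp add: c_def field_simps)
    also have "\<dots> \<le> (2 * real n + 1) * norm x"
      by (intro mult_right_mono) auto
    finally show ?thesis
      using e by (simp add: field_simps)
  qed
  then show ?thesis
    using e by (intro exI[of _ "(2 * real n + 1) / e"]) (auto intro!: divide_pos_pos)
qed

text \<open>Continuity into the space with the supremum norm needs uniformity in \<open>x\<close>,
which compactness of the box provides. Outside the box the functions are extended by the values at
the nearest point of the box.\<close>

lemma curried_continuous_bcontfun: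
  fixes g :: "'t::topological_space \<Rightarrow> 'a::euclidean_space \<Rightarrow> 'b::metric_space"
  assumes cont: "continuous_on (A \<times> cbox a b) (\<lambda>(t, x). g t x)"
  obtains h :: "'t \<Rightarrow> 'a \<Rightarrow>\<^sub>C 'b"
  where "continuous_on A h" "\<And>t x. t \<in> A \<Longrightarrow> x \<in> cbox a b \<Longrightarrow> apply_bcontfun (h t) x = g t x"
proof (cases "cbox a b = {}")
  case True
  show thesis
    by (rule that[of "\<lambda>_. undefined"]) (use True in auto)
next
  case False
  then have clamp: "clamp a b x \<in> cbox a b" for x
    by (auto simp: box_ne_empty)
  have "\<exists>G :: 'a \<Rightarrow>\<^sub>C 'b. (\<forall>x\<in>cbox a b. G x = g t x) \<and> (\<forall>x. G x = g t (clamp a b x))"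
    if "t \<in> A" for t
  proof -
    have "continuous_on (cbox a b) (g t)"
      using continuous_on_compose2[OF cont, of "cbox a b" "\<lambda>x. (t, x)"] that
      by (force intro!: continuous_intros)
    then show ?thesis
      by (elim continuous_on_cbox_bcontfunE) blast
  qed
  then obtain h :: "'t \<Rightarrow> 'a \<Rightarrow>\<^sub>C 'b" where
    h: "\<And>t x. t \<in> A \<Longrightarrow> x \<in> cbox a b \<Longrightarrow> h t x = g t x"
      "\<And>t x. t \<in> A \<Longrightarrow> h t x = g t (clamp a b x)"
    by metis
  have "continuous_on A h"
    unfolding continuous_on_topological
  proof safe
    fix t B assume t: "t \<in> A" and B: "open B" "h t \<in> B"
    then obtain e where e: "e > 0" "\<And>G. dist G (h t) < e \<Longrightarrow> G \<in> B"
      by (meson open_dist)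
    obtain X where X: "t \<in> X" "open X" "\<forall>s\<in>X \<inter> A. \<forall>x\<in>cbox a b.
        dist ((\<lambda>(t, x). g t x) (s, x)) ((\<lambda>(t, x). g t x) (t, x)) \<le> e / 2"
      using continuous_on_prod_compactE[OF cont compact_cbox t, of "e / 2"] e by auto
    have "h s \<in> B" if "s \<in> A" "s \<in> X" for s
    proof (rule e(2))
      have "dist (h s) (h t) \<le> e / 2"
        using X that t clamp by (intro dist_bound) (auto simp: h(2))
      then show "dist (h s) (h t) < e"
        using e by simp
    qed
    then show "\<exists>X. open X \<and> t \<in> X \<and> (\<forall>s\<in>A. s \<in> X \<longrightarrow> h s \<in> B)"
      using X by blast
  qed
  then show thesis
    using h(1) that by blast
qed

section \<open>Linearity of the scattering problem\<close>

lemma partial_deriv_cong: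
  assumes "open S" "x \<in> S" "u differentiable (at x)" "\<And>y. y \<in> S \<Longrightarrow> u y = v y"
  shows "partial_deriv i u x = partial_deriv i v x"
  unfolding partial_deriv_def
  using frechet_derivative_transform_within_open[OF assms(3,1,2) assms(4)] by presburger

lemma frechet_derivative_lincomb:
  fixes u v :: "real ^ 2 \<Rightarrow> complex"
  assumes "u differentiable (at x)" "v differentiable (at x)"
  shows "frechet_derivative (\<lambda>x. a * u x + b * v x) (at x) =
    (\<lambda>h. a * frechet_derivative u (at x) h + b * frechet_derivative v (at x) h)"
proof -
  have "((\<lambda>x. a * u x + b * v x) has_derivative
    (\<lambda>h. a * frechet_derivative u (at x) h + b * frechet_derivative v (at x) h)) (at x)"
    using assms
    by (intro has_derivative_add has_derivative_mult_right) (simp_all flip: frechet_derivative_works)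
  then show ?thesis
    by (rule frechet_derivative_at[symmetric])
qed

lemma partial_deriv_lincomb:
  assumes "u differentiable (at x)" "v differentiable (at x)"
  shows "partial_deriv i (\<lambda>x. a * u x + b * v x) x = a * partial_deriv i u x + b * partial_deriv i v x"
  by (simp add: partial_deriv_def frechet_derivative_lincomb[OF assms])

lemma C1_on_lincomb:
  assumes "C1_on S u" "C1_on S v"
  shows "C1_on S (\<lambda>x. a * u x + b * v x)"
proof -
  have "continuous_on S (partial_deriv i (\<lambda>x. a * u x + b * v x))" for i
  proof -
    have "continuous_on S (\<lambda>x. a * partial_deriv i u x + b * partial_deriv i v x)"
      using assms by (intro continuous_intros) (simp_all add: C1_on_def)
    then show ?thesis
      by (rule continuous_on_eq) (use assms in \<open>simp add: C1_on_def partial_deriv_lincomb\<close>)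
  qed
  then show ?thesis
    using assms by (simp add: C1_on_def)
qed

lemma C1_on_cong:
  assumes "open S" "C1_on S u" "\<And>x. x \<in> S \<Longrightarrow> u x = v x"
  shows "C1_on S v"
proof -
  have "v differentiable (at x)" if "x \<in> S" for x
  proof -
    have "u differentiable (at x)"
      using assms(2) that by (simp add: C1_on_def)
    then obtain u' where "(u has_derivative u') (at x)"
      unfolding differentiable_def by blast
    then have "(v has_derivative u') (at x)"
      by (rule has_derivative_transform_within_open[OF _ assms(1) that]) (rule assms(3))
    then show ?thesis
      unfolding differentiable_def by blast
  qed
  moreover have "continuous_on S (partial_deriv i v)" for i
  proof (rule continuous_on_eq)
    show "continuous_on S (partial_deriv i u)"
      using assms(2) by (simp add: C1_on_def)
    show "partial_deriv i u x = partial_deriv i v x" if "x \<in> S" for x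
      by (rule partial_deriv_cong[OF assms(1) that _ assms(3)])
        (use assms(2) that in \<open>simp_all add: C1_on_def\<close>)
  qed
  ultimately show ?thesis
    by (auto simp: C1_on_def)
qed

text \<open>Derivatives of second order are derivatives of functions that agree with the expected
linear combination only on \<open>S\<close>; openness of \<open>S\<close> makes this agreement sufficient.\<close>

lemma C2_on_lincomb:
  assumes "open S" "C2_on S u" "C2_on S v"
  shows "C2_on S (\<lambda>x. a * u x + b * v x)"
proof -
  have "C1_on S (partial_deriv i (\<lambda>x. a * u x + b * v x))" for i
  proof (rule C1_on_cong[OF assms(1)])
    show "C1_on S (\<lambda>x. a * partial_deriv i u x + b * partial_deriv i v x)"
      using assms(2,3) by (intro C1_on_lincomb) (simp_all add: C2_on_def)
    show "a * partial_deriv i u x + b * partial_deriv i v x =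
        partial_deriv i (\<lambda>x. a * u x + b * v x) x" if "x \<in> S" for x
      using assms(2,3) that by (simp add: C2_on_def C1_on_def partial_deriv_lincomb)
  qed
  then show ?thesis
    using assms(2,3) by (simp add: C2_on_def C1_on_lincomb)
qed

lemma laplacian_lincomb:
  assumes "open S" "C2_on S u" "C2_on S v" "x \<in> S"
  shows "laplacian (\<lambda>x. a * u x + b * v x) x = a * laplacian u x + b * laplacian v x"
proof -
  have "partial_deriv i (partial_deriv i (\<lambda>x. a * u x + b * v x)) x =
    a * partial_deriv i (partial_deriv i u) x + b * partial_deriv i (partial_deriv i v) x" for i
  proof -
    have "partial_deriv i (\<lambda>x. a * partial_deriv i u x + b * partial_deriv i v x) x =
        partial_deriv i (partial_deriv i (\<lambda>x. a * u x + b * v x)) x"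
    proof (rule partial_deriv_cong[OF assms(1,4)])
      show "(\<lambda>x. a * partial_deriv i u x + b * partial_deriv i v x) differentiable (at x)"
        using assms(2,3,4) by (intro derivative_intros) (simp_all add: C2_on_def C1_on_def)
      show "a * partial_deriv i u y + b * partial_deriv i v y =
          partial_deriv i (\<lambda>x. a * u x + b * v x) y" if "y \<in> S" for y
        using assms(2,3) that by (simp add: C2_on_def C1_on_def partial_deriv_lincomb)
    qed
    then show ?thesis
      using assms(2,3,4) by (simp add: C2_on_def C1_on_def partial_deriv_lincomb)
  qed
  then show ?thesis
    by (simp add: laplacian_def sum.distrib sum_distrib_left)
qed

definition radiation_residual :: "real \<Rightarrow> real \<Rightarrow> (real ^ 2 \<Rightarrow> complex) \<Rightarrow> real ^ 2 \<Rightarrow> complex" where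
  "radiation_residual kp km u x =
     radial_deriv u x - \<i> * of_real (wave_number kp km x) * u x"

lemma radial_deriv_eq:
  assumes "u differentiable (at x)"
  shows "radial_deriv u x = (\<Sum>i\<in>UNIV. of_real (x $ i / norm x) * partial_deriv i u x)"
proof -
  have "x /\<^sub>R norm x = (\<Sum>i\<in>UNIV. (x $ i / norm x) *\<^sub>R axis i 1)"
    by (simp add: vec_eq_iff axis_def sum_distrib_left if_distrib[of "\<lambda>a. _ * a"] divide_inverse_commute
        cong: if_cong)
  then show ?thesis
    using linear_frechet_derivative[OF assms]
    by (simp add: radial_deriv_def partial_deriv_def linear_sum linear_scale
        scaleR_conv_of_real[where 'a = complex])
qed

lemma open_halves: "open upper" "open lower" "closed interface"
proof -
  show "open upper" "open lower"
    unfolding upper_def lower_def by (intro open_Collect_less continuous_intros)+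
  show "closed interface"
    unfolding interface_def by (intro closed_Collect_eq continuous_intros)
qed

lemma continuous_on_radiation_residual:
  assumes "open S" "S \<inter> interface = {}" "C1_on S u"
  shows "continuous_on S (radiation_residual kp km u)"
proof -
  have S: "S = (S \<inter> upper) \<union> (S \<inter> lower)"
    using assms(2) by (force simp: interface_def upper_def lower_def)
  have "continuous_on (S \<inter> upper) (wave_number kp km)"
    by (rule continuous_on_eq[OF continuous_on_const[of _ kp]]) (simp add: wave_number_def)
  moreover have "continuous_on (S \<inter> lower) (wave_number kp km)"
    by (rule continuous_on_eq[OF continuous_on_const[of _ km]])
      (auto simp: wave_number_def lower_def upper_def)
  ultimately have "continuous_on ((S \<inter> upper) \<union> (S \<inter> lower)) (wave_number kp km)"
    by (intro continuous_on_open_Un open_Int open_halves assms(1))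
  then have k: "continuous_on S (wave_number kp km)"
    using S by simp
  have nz: "x \<noteq> 0" if "x \<in> S" for x
    using that assms(2) by (auto simp: interface_def)
  have diff: "u differentiable (at x)" if "x \<in> S" for x
    using that assms(3) by (simp add: C1_on_def)
  have u: "continuous_on S u"
    by (intro continuous_at_imp_continuous_on ballI differentiable_imp_continuous_within diff)
  have p: "continuous_on S (partial_deriv i u)" for i
    using assms(3) by (simp add: C1_on_def)
  have "continuous_on S (\<lambda>x. (\<Sum>i\<in>UNIV. of_real (x $ i / norm x) * partial_deriv i u x)
      - \<i> * of_real (wave_number kp km x) * u x)"
    by (intro continuous_intros p u k) (use nz in auto)
  then show ?thesis
    by (rule continuous_on_eq) (simp add: radiation_residual_def radial_deriv_eq diff)
qed

lemma radiation_residual_lincomb: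
  assumes "u differentiable (at x)" "v differentiable (at x)"
  shows "radiation_residual kp km (\<lambda>x. a * u x + b * v x) x =
    a * radiation_residual kp km u x + b * radiation_residual kp km v x"
  by (simp add: radiation_residual_def radial_deriv_def frechet_derivative_lincomb[OF assms]
      algebra_simps)

lemma norm_dir [simp]: "norm (dir t) = 1"
  by (simp add: dir_def norm_vec_def L2_set_def sum_2)

lemma dir_in_upper: "0 < t \<Longrightarrow> t < pi \<Longrightarrow> dir t \<in> upper"
  by (simp add: dir_def upper_def sin_gt_zero)

lemma continuous_on_dir [continuous_intros]:
  fixes f :: "'a::t2_space \<Rightarrow> real"
  shows "continuous_on S f \<Longrightarrow> continuous_on S (\<lambda>x. dir (f x))"
proof -
  assume f: "continuous_on S f"
  have "continuous_on S (\<lambda>x. (\<chi> i. if i = 1 then cos (f x) else sin (f x)) :: real ^ 2)"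
  proof (intro continuous_on_vec_lambda)
    show "continuous_on S (\<lambda>x. if i = 1 then cos (f x) else sin (f x))" for i :: 2
      by (cases "i = 1") (auto intro!: continuous_intros f)
  qed
  moreover have "dir t = (\<chi> i. if i = 1 then cos t else sin t)" for t
    by (simp add: dir_def vec_eq_iff forall_2)
  ultimately show ?thesis
    by simp
qed

lemma norm_lincomb_square_le:
  fixes a b p q :: complex
  shows "(cmod (a * p + b * q))\<^sup>2 \<le> 2 * (cmod a)\<^sup>2 * (cmod p)\<^sup>2 + 2 * (cmod b)\<^sup>2 * (cmod q)\<^sup>2"
proof -
  have "(cmod (a * p + b * q))\<^sup>2 \<le> (cmod a * cmod p + cmod b * cmod q)\<^sup>2"
    by (intro power_mono order_trans[OF norm_triangle_ineq]) (simp_all add: norm_mult)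
  also have "\<dots> \<le> 2 * (cmod a * cmod p)\<^sup>2 + 2 * (cmod b * cmod q)\<^sup>2"
    using sum_squares_bound[of "cmod a * cmod p" "cmod b * cmod q"] by (simp add: power2_sum)
  finally show ?thesis
    by (simp add: power_mult_distrib)
qed

text \<open>The integral in the radiation condition is a squared \<open>L\<^sup>2\<close> norm on the circle,
so it is bounded through \<open>|a p + b q|\<^sup>2 \<le> 2 |a p|\<^sup>2 + 2 |b q|\<^sup>2\<close>. To split
the upper bound into two integrals one needs measurable integrands: on large circles they are
continuous away from the points of the interface, a null set of angles.\<close>

lemma radiation_condition_lincomb:
  assumes D: "bounded D"
    and S: "S = - (closure D \<union> interface)"
    and u: "C1_on S u" "radiation_condition kp km u"
    and v: "C1_on S v" "radiation_condition kp km v"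
  shows "radiation_condition kp km (\<lambda>x. a * u x + b * v x)"
proof -
  define E where "E w r = (\<integral>\<^sup>+\<theta>\<in>{0..2 * pi}.
    ennreal (r * (cmod (radiation_residual kp km w (r *\<^sub>R dir \<theta>)))\<^sup>2) \<partial>lborel)" for w r
  have rad: "radiation_condition kp km w \<longleftrightarrow> (E w \<longlongrightarrow> 0) at_top" for w
    by (simp add: radiation_condition_def E_def[abs_def] radiation_residual_def)
  obtain R where R: "R > 0" "closure D \<subseteq> ball 0 R"
    using bounded_subset_ballD[OF bounded_closure[OF D]] by auto
  define W :: "real set" where "W = {0<..<pi} \<union> {pi<..<2 * pi}"
  have open_S: "open S"
    unfolding S by (intro open_Compl closed_Un closed_closure open_halves)
  have W_S: "r *\<^sub>R dir t \<in> S" if "r \<ge> R" "t \<in> W" for r t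
  proof -
    have "sin t \<noteq> 0"
      using that(2) sin_gt_zero[of t] sin_lt_zero[of t] by (auto simp: W_def)
    then have "r *\<^sub>R dir t \<notin> interface"
      using that(1) R(1) by (simp add: interface_def dir_def)
    moreover have "r *\<^sub>R dir t \<notin> closure D"
      using that(1) R by force
    ultimately show ?thesis
      by (simp add: S)
  qed
  have E_W: "E w r = (\<integral>\<^sup>+\<theta>.
      indicator W \<theta> * ennreal (r * (cmod (radiation_residual kp km w (r *\<^sub>R dir \<theta>)))\<^sup>2) \<partial>lborel)" for w r
    unfolding E_def
  proof (rule nn_integral_cong_AE)
    have "AE t in lborel. t \<notin> {0, pi, 2 * pi}"
      by (intro AE_not_in countable_imp_null_set_lborel) auto
    then show "AE t in lborel. ennreal (r * (cmod (radiation_residual kp km w (r *\<^sub>R dir t)))\<^sup>2) *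
        indicator {0..2 * pi} t =
        indicator W t * ennreal (r * (cmod (radiation_residual kp km w (r *\<^sub>R dir t)))\<^sup>2)"
      by eventually_elim (auto simp: W_def indicator_def)
  qed
  have meas: "(\<lambda>t. indicator W t * ennreal (r * (cmod (radiation_residual kp km w (r *\<^sub>R dir t)))\<^sup>2))
      \<in> borel_measurable lborel" if "r \<ge> R" "C1_on S w" for w r
  proof -
    have "continuous_on W (\<lambda>t. radiation_residual kp km w (r *\<^sub>R dir t))"
      by (rule continuous_on_compose2[OF continuous_on_radiation_residual[OF open_S _ that(2)]])
        (use W_S[OF that(1)] in \<open>auto simp: S intro!: continuous_intros\<close>)
    then have "(\<lambda>t. indicator W t *\<^sub>R (r * (cmod (radiation_residual kp km w (r *\<^sub>R dir t)))\<^sup>2))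
        \<in> borel_measurable borel"
      by (intro borel_measurable_continuous_on_indicator) (auto simp: W_def intro!: continuous_intros)
    then have "(\<lambda>t. ennreal (indicator W t *\<^sub>R (r * (cmod (radiation_residual kp km w (r *\<^sub>R dir t)))\<^sup>2)))
        \<in> borel_measurable lborel"
      by simp
    moreover have "ennreal (indicator W t *\<^sub>R (r * (cmod (radiation_residual kp km w (r *\<^sub>R dir t)))\<^sup>2)) =
        indicator W t * ennreal (r * (cmod (radiation_residual kp km w (r *\<^sub>R dir t)))\<^sup>2)" for t
      by (auto simp: indicator_def)
    ultimately show ?thesis
      by simp
  qed
  define A B where "A = 2 * (cmod a)\<^sup>2" and "B = 2 * (cmod b)\<^sup>2"
  have AB: "A \<ge> 0" "B \<ge> 0"
    by (simp_all add: A_def B_def)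
  have bound: "E (\<lambda>x. a * u x + b * v x) r \<le> ennreal A * E u r + ennreal B * E v r" if r: "r \<ge> R" for r
  proof -
    let ?e = "\<lambda>w t. indicator W t * ennreal (r * (cmod (radiation_residual kp km w (r *\<^sub>R dir t)))\<^sup>2)"
    have "?e (\<lambda>x. a * u x + b * v x) t \<le> ennreal A * ?e u t + ennreal B * ?e v t" for t
    proof (cases "t \<in> W")
      case True
      have "r * (cmod (radiation_residual kp km (\<lambda>x. a * u x + b * v x) (r *\<^sub>R dir t)))\<^sup>2 \<le>
        r * (A * (cmod (radiation_residual kp km u (r *\<^sub>R dir t)))\<^sup>2 +
             B * (cmod (radiation_residual kp km v (r *\<^sub>R dir t)))\<^sup>2)"
        using W_S[OF r True] u v norm_lincomb_square_le R r
        by (subst radiation_residual_lincomb) (auto simp: C1_on_def A_def B_def intro!: mult_left_mono)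
      then have "ennreal (r * (cmod (radiation_residual kp km (\<lambda>x. a * u x + b * v x) (r *\<^sub>R dir t)))\<^sup>2) \<le>
        ennreal (A * (r * (cmod (radiation_residual kp km u (r *\<^sub>R dir t)))\<^sup>2) +
             B * (r * (cmod (radiation_residual kp km v (r *\<^sub>R dir t)))\<^sup>2))"
        by (intro ennreal_leI) (simp add: algebra_simps)
      then show ?thesis
        using True AB r R by (simp add: ennreal_plus ennreal_mult)
    qed simp
    then have "E (\<lambda>x. a * u x + b * v x) r \<le> (\<integral>\<^sup>+t. ennreal A * ?e u t + ennreal B * ?e v t \<partial>lborel)"
      unfolding E_W by (intro nn_integral_mono)
    also have "\<dots> = ennreal A * E u r + ennreal B * E v r"
      unfolding E_W using meas[OF r u(1)] meas[OF r v(1)]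
      by (subst nn_integral_add) (simp_all add: nn_integral_cmult)
    finally show ?thesis .
  qed
  have "((\<lambda>r. ennreal A * E u r + ennreal B * E v r) \<longlongrightarrow> ennreal A * 0 + ennreal B * 0) at_top"
    using u(2) v(2) unfolding rad by (intro tendsto_add ennreal_tendsto_cmult) auto
  then have "((\<lambda>r. ennreal A * E u r + ennreal B * E v r) \<longlongrightarrow> 0) at_top"
    by simp
  then show ?thesis
    unfolding rad
    by (rule tendsto_sandwich[OF _ _ tendsto_const, rotated 2])
      (use bound in \<open>auto intro: eventually_at_top_linorderI[of R]\<close>)
qed

text \<open>The agreement of \<open>w\<close> with the linear combination is required only off the interface, since
partial derivatives of a transmission solution need not exist on it.\<close>

lemma no_jump_at_lincomb:
  assumes "no_jump_at p x" "no_jump_at q x" "open X" "x \<in> X"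
    and "\<And>y. y \<in> X \<Longrightarrow> y \<in> upper \<union> lower \<Longrightarrow> w y = a * p y + b * q y"
  shows "no_jump_at w x"
proof -
  obtain l m where l: "(p \<longlongrightarrow> l) (at x within upper)" "(p \<longlongrightarrow> l) (at x within lower)"
    and m: "(q \<longlongrightarrow> m) (at x within upper)" "(q \<longlongrightarrow> m) (at x within lower)"
    using assms(1,2) unfolding no_jump_at_def by blast
  have "(w \<longlongrightarrow> a * l + b * m) (at x within H)"
    if "(p \<longlongrightarrow> l) (at x within H)" "(q \<longlongrightarrow> m) (at x within H)" "H \<subseteq> upper \<union> lower" for H
  proof (rule Lim_transform_eventually)
    show "((\<lambda>y. a * p y + b * q y) \<longlongrightarrow> a * l + b * m) (at x within H)"
      using that by (intro tendsto_intros)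
    show "\<forall>\<^sub>F y in at x within H. a * p y + b * q y = w y"
      unfolding eventually_at_topological using assms(3-5) that(3) by (metis subsetD)
  qed
  then show ?thesis
    unfolding no_jump_at_def using l m by blast
qed

lemma scattering_solution_lincomb:
  assumes D: "bounded D" "closure D \<subseteq> lower"
    and u: "scattering_solution D kp km f u" and v: "scattering_solution D kp km g v"
    and h: "\<And>x. x \<in> frontier D \<Longrightarrow> h x = a * f x + b * g x"
  shows "scattering_solution D kp km h (\<lambda>x. a * u x + b * v x)"
proof -
  define S where "S = - (closure D \<union> interface)"
  have open_S: "open S"
    unfolding S_def by (intro open_Compl closed_Un closed_closure open_halves)
  have C2: "C2_on S u" "C2_on S v"
    using u v by (simp_all add: scattering_solution_def S_def)
  have halves: "y \<in> S" if "y \<in> - closure D" "y \<in> upper \<union> lower" for y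
    using that by (auto simp: S_def interface_def upper_def lower_def)
  have "continuous_on (- D) (\<lambda>x. a * u x + b * v x)"
    using u v by (intro continuous_intros) (simp_all add: scattering_solution_def)
  moreover have "laplacian (\<lambda>x. a * u x + b * v x) x +
      (of_real (wave_number kp km x))\<^sup>2 * (a * u x + b * v x) = 0" if "x \<in> S" for x
  proof -
    have "laplacian u x + (of_real (wave_number kp km x))\<^sup>2 * u x = 0"
      "laplacian v x + (of_real (wave_number kp km x))\<^sup>2 * v x = 0"
      using u v that unfolding scattering_solution_def S_def by blast+
    then show ?thesis
      unfolding laplacian_lincomb[OF open_S C2 that] by algebra
  qed
  moreover have "no_jump_at (\<lambda>x. a * u x + b * v x) x \<and>
      no_jump_at (partial_deriv 2 (\<lambda>x. a * u x + b * v x)) x" if x: "x \<in> interface" for x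
  proof
    have traces: "no_jump_at u x" "no_jump_at v x"
      "no_jump_at (partial_deriv 2 u) x" "no_jump_at (partial_deriv 2 v) x"
      using u v x unfolding scattering_solution_def by blast+
    have X: "open (- closure D)" "x \<in> - closure D"
      using D x by (auto simp: interface_def lower_def)
    show "no_jump_at (\<lambda>x. a * u x + b * v x) x"
      by (rule no_jump_at_lincomb[OF traces(1,2) X]) simp
    show "no_jump_at (partial_deriv 2 (\<lambda>x. a * u x + b * v x)) x"
    proof (rule no_jump_at_lincomb[OF traces(3,4) X])
      fix y assume "y \<in> - closure D" "y \<in> upper \<union> lower"
      then have "y \<in> S"
        by (rule halves)
      then show "partial_deriv 2 (\<lambda>x. a * u x + b * v x) y =
          a * partial_deriv 2 u y + b * partial_deriv 2 v y"
        using C2 by (simp add: C2_on_def C1_on_def partial_deriv_lincomb)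
    qed
  qed
  moreover have "radiation_condition kp km (\<lambda>x. a * u x + b * v x)"
    using C2 u v
    by (intro radiation_condition_lincomb[OF D(1) S_def])
      (simp_all add: C2_on_def scattering_solution_def)
  moreover have "a * u x + b * v x = h x" if "x \<in> frontier D" for x
    using u v h[OF that] that by (simp add: scattering_solution_def)
  ultimately show ?thesis
    using C2_on_lincomb[OF open_S C2] unfolding scattering_solution_def S_def by blast
qed

section \<open>Far-field patterns\<close>

text \<open>The solution along a ray, divided by the outgoing cylindrical wave: the far-field pattern is its
limit as the radius \<open>r\<close> grows.\<close>

definition rescaled :: "real \<Rightarrow> real \<Rightarrow> (real ^ 2 \<Rightarrow> complex) \<Rightarrow> real ^ 2 \<Rightarrow> complex" where
  "rescaled k r u y = of_real (sqrt r) * exp (- \<i> * of_real (k * r)) * u (r *\<^sub>R y)"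

lemma rescaled_converges_uniformly:
  assumes "is_far_field_pattern k u U" "e > 0"
  shows "\<exists>R>0. \<forall>r\<ge>R. \<forall>y. norm y = 1 \<longrightarrow> y \<in> upper \<longrightarrow> cmod (rescaled k r u y - U y) \<le> e"
proof -
  have "\<forall>\<^sub>F x in inf at_infinity (principal upper).
      cmod (u x - exp (\<i> * of_real (k * norm x)) / of_real (sqrt (norm x)) * U (x /\<^sub>R norm x))
        \<le> e * cmod (of_real (1 / sqrt (norm x)))"
    using landau_o.smallD[OF assms(1)[unfolded is_far_field_pattern_def] assms(2)] .
  then obtain R where R: "\<And>x. norm x \<ge> R \<Longrightarrow> x \<in> upper \<Longrightarrow>
      cmod (u x - exp (\<i> * of_real (k * norm x)) / of_real (sqrt (norm x)) * U (x /\<^sub>R norm x))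
        \<le> e / sqrt (norm x)"
    unfolding eventually_inf_principal eventually_at_infinity
    by (auto simp: norm_divide)
  have "cmod (rescaled k r u y - U y) \<le> e" if "r \<ge> max R 1" "norm y = 1" "y \<in> upper" for r y
  proof -
    let ?c = "of_real (sqrt r) * exp (- \<i> * of_real (k * r)) :: complex"
    let ?E = "exp (\<i> * of_real (k * r)) / of_real (sqrt r) :: complex"
    have r: "r > 0"
      using that(1) by simp
    have "exp (- \<i> * of_real (k * r)) * exp (\<i> * of_real (k * r)) = (1 :: complex)"
      by (simp flip: exp_add)
    then have "?c * ?E = 1"
      using r by (simp add: field_simps)
    then have "rescaled k r u y - U y = ?c * (u (r *\<^sub>R y) - ?E * U y)"
      unfolding rescaled_def by (metis (no_types, lifting) mult.assoc mult_1 right_diff_distrib)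
    also have "cmod \<dots> = sqrt r * cmod (u (r *\<^sub>R y) - ?E * U y)"
      using r by (simp add: norm_mult)
    also have "\<dots> \<le> sqrt r * (e / sqrt r)"
      using R[of "r *\<^sub>R y"] that r by (intro mult_left_mono) (simp_all add: upper_def)
    finally show ?thesis
      using r by simp
  qed
  then show ?thesis
    by (intro exI[of _ "max R 1"]) auto
qed

lemma rescaled_tendsto:
  assumes "is_far_field_pattern k u U" "norm y = 1" "y \<in> upper"
  shows "((\<lambda>r. rescaled k r u y) \<longlongrightarrow> U y) at_top"
proof (rule tendstoI)
  fix e :: real assume "e > 0"
  then obtain R where "\<forall>r\<ge>R. cmod (rescaled k r u y - U y) \<le> e / 2"
    using rescaled_converges_uniformly[OF assms(1), of "e / 2"] assms(2,3) by auto
  then show "\<forall>\<^sub>F r in at_top. dist (rescaled k r u y) (U y) < e"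
    using \<open>e > 0\<close> by (intro eventually_at_top_linorderI[of R]) (force simp: dist_norm)
qed

lemma is_far_field_pattern_cong:
  assumes "is_far_field_pattern k u U" "\<And>x. x \<in> upper \<Longrightarrow> u x = v x"
    and "\<And>y. norm y = 1 \<Longrightarrow> y \<in> upper \<Longrightarrow> U y = V y"
  shows "is_far_field_pattern k v V"
proof -
  have "\<forall>\<^sub>F x in inf at_infinity (principal upper).
      u x - exp (\<i> * of_real (k * norm x)) / of_real (sqrt (norm x)) * U (x /\<^sub>R norm x) =
      v x - exp (\<i> * of_real (k * norm x)) / of_real (sqrt (norm x)) * V (x /\<^sub>R norm x)"
    unfolding eventually_inf_principal
  proof (intro always_eventually allI impI)
    fix x assume x: "x \<in> upper"
    then have "x \<noteq> 0"
      by (auto simp: upper_def)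
    then have "norm (x /\<^sub>R norm x) = 1" "x /\<^sub>R norm x \<in> upper"
      using x by (simp_all add: upper_def)
    then show "u x - exp (\<i> * of_real (k * norm x)) / of_real (sqrt (norm x)) * U (x /\<^sub>R norm x) =
      v x - exp (\<i> * of_real (k * norm x)) / of_real (sqrt (norm x)) * V (x /\<^sub>R norm x)"
      using assms(2)[OF x] assms(3) by metis
  qed
  then show ?thesis
    using assms(1) unfolding is_far_field_pattern_def
    by (rule landau_o.small.in_cong[THEN iffD1])
qed

lemma far_field_pattern_unique:
  assumes "is_far_field_pattern k u U" "is_far_field_pattern k u V" "norm y = 1" "y \<in> upper"
  shows "U y = V y"
  using tendsto_unique[OF _ rescaled_tendsto[OF assms(1,3,4)] rescaled_tendsto[OF assms(2-4)]] by simp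

lemma is_far_field_pattern_lincomb:
  assumes "is_far_field_pattern k u U" "is_far_field_pattern k v V"
  shows "is_far_field_pattern k (\<lambda>x. a * u x + b * v x) (\<lambda>y. a * U y + b * V y)"
proof -
  let ?E = "\<lambda>x :: real ^ 2. exp (\<i> * of_real (k * norm x)) / of_real (sqrt (norm x)) :: complex"
  have "(\<lambda>x. a * (u x - ?E x * U (x /\<^sub>R norm x)) + b * (v x - ?E x * V (x /\<^sub>R norm x)))
    \<in> o[inf at_infinity (principal upper)](\<lambda>x. of_real (1 / sqrt (norm x)))"
    using assms unfolding is_far_field_pattern_def
    by (intro sum_in_smallo) (simp_all only: cmult_in_smallo_iff simp_thms)
  moreover have "(\<lambda>x. a * (u x - ?E x * U (x /\<^sub>R norm x)) + b * (v x - ?E x * V (x /\<^sub>R norm x))) =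
    (\<lambda>x. a * u x + b * v x - ?E x * (a * U (x /\<^sub>R norm x) + b * V (x /\<^sub>R norm x)))"
    by (simp add: fun_eq_iff algebra_simps)
  ultimately show ?thesis
    unfolding is_far_field_pattern_def by simp
qed

text \<open>Together with uniqueness on the open half-circle, the normalization by \<open>0\<close> elsewhere makes
the definite description well defined.\<close>

lemma far_field_pattern_eq:
  assumes "is_far_field_pattern k u U"
  shows "far_field_pattern k u = (\<lambda>y. if norm y = 1 \<and> y \<in> upper then U y else 0)"
  unfolding far_field_pattern_def
proof (rule the_equality)
  show "is_far_field_pattern k u (\<lambda>y. if norm y = 1 \<and> y \<in> upper then U y else 0) \<and>
    (\<forall>y. \<not> (norm y = 1 \<and> y \<in> upper) \<longrightarrow> (if norm y = 1 \<and> y \<in> upper then U y else 0) = 0)"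
    using is_far_field_pattern_cong[OF assms, of u "\<lambda>y. if norm y = 1 \<and> y \<in> upper then U y else 0"]
    by simp
next
  fix V assume "is_far_field_pattern k u V \<and> (\<forall>y. \<not> (norm y = 1 \<and> y \<in> upper) \<longrightarrow> V y = 0)"
  then show "V = (\<lambda>y. if norm y = 1 \<and> y \<in> upper then U y else 0)"
    using far_field_pattern_unique[OF _ assms] by (auto simp: fun_eq_iff)
qed

section \<open>Transmitted plane waves\<close>

lemma theta_c_bounds:
  assumes "kp > 0" "km > 0"
  shows "0 \<le> theta_c kp km" "theta_c kp km \<le> pi / 2"
  using arccos_lbound[of "km / kp"] arccos_le_pi2[of "km / kp"] divide_pos_pos[OF assms(2,1)] assms
  by (auto simp: theta_c_def)

text \<open>Incidence angles are restricted by the critical angle precisely so that Snell's law can be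
solved for a real angle of refraction.\<close>

lemma refracted_cosine_bound:
  assumes k: "kp > 0" "km > 0" and t: "t \<in> arc_minus kp km"
  shows "\<bar>kp / km * cos t\<bar> \<le> 1"
proof (cases "kp > km")
  case True
  define s where "s = t - pi"
  have c: "theta_c kp km = arccos (km / kp)"
    using True by (simp add: theta_c_def)
  have s: "arccos (km / kp) \<le> s" "s \<le> pi - arccos (km / kp)"
    using t by (simp_all add: arc_minus_def c s_def)
  have "0 < km / kp" "km / kp \<le> 1"
    using k True by simp_all
  then have ac: "0 \<le> arccos (km / kp)" "arccos (km / kp) \<le> pi" "cos (arccos (km / kp)) = km / kp"
    by (auto intro!: arccos_lbound arccos_ubound cos_arccos)
  have "cos s \<le> cos (arccos (km / kp))"
    using s ac by (intro cos_monotone_0_pi_le) auto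
  moreover have "cos (pi - arccos (km / kp)) \<le> cos s"
    using s ac by (intro cos_monotone_0_pi_le) auto
  moreover have "cos t = - cos s"
    by (simp add: s_def cos_diff)
  ultimately have "\<bar>cos t\<bar> \<le> km / kp"
    using ac by (simp add: abs_le_iff cos_diff)
  then show ?thesis
    using k by (simp add: abs_mult field_simps)
next
  case False
  have "kp / km * \<bar>cos t\<bar> \<le> 1 * 1"
    using False k by (intro mult_mono) auto
  then show ?thesis
    using k by (simp add: abs_mult)
qed

lemma theta_t_eq:
  assumes k: "kp > 0" "km > 0" and t: "t \<in> arc_minus kp km"
  shows "theta_t kp km t = 2 * pi - arccos (kp / km * cos t)"
  unfolding theta_t_def
proof (rule the_equality)
  have c: "- 1 \<le> kp / km * cos t" "kp / km * cos t \<le> 1"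
    using refracted_cosine_bound[OF k t] by linarith+
  show "2 * pi - arccos (kp / km * cos t) \<in> {pi..2 * pi} \<and>
      kp * cos t = km * cos (2 * pi - arccos (kp / km * cos t))"
    using arccos_lbound[OF c] arccos_ubound[OF c] k cos_arccos[OF c] by (simp add: cos_diff)
  fix s assume s: "s \<in> {pi..2 * pi} \<and> kp * cos t = km * cos s"
  then have "cos (2 * pi - s) = kp / km * cos t"
    using k by (simp add: cos_diff field_simps)
  then show "s = 2 * pi - arccos (kp / km * cos t)"
    using s arccos_cos[of "2 * pi - s"] by simp
qed

lemma continuous_on_theta_t:
  assumes k: "kp > 0" "km > 0"
  shows "continuous_on (arc_minus kp km) (theta_t kp km)"
proof -
  have "continuous_on (arc_minus kp km) (\<lambda>t. 2 * pi - arccos (kp / km * cos t))"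
  proof (intro continuous_intros ballI)
    fix t assume t: "t \<in> arc_minus kp km"
    show "- 1 \<le> kp / km * cos t \<and> kp / km * cos t \<le> 1"
      using refracted_cosine_bound[OF k t] by linarith
  qed
  then show ?thesis
    by (rule continuous_on_eq) (simp add: theta_t_eq[OF k])
qed

text \<open>Both sines are nonpositive on \<open>[\<pi>, 2 \<pi>]\<close>, so the sum could vanish only if both
of them do. Then both cosines are \<open>1\<close> or \<open>-1\<close>, and Snell's law forces the wave
numbers to be equal.\<close>

lemma transmission_denominator_nonzero:
  assumes k: "kp > 0" "km > 0" "kp \<noteq> km" and t: "t \<in> arc_minus kp km"
  shows "kp * sin t + km * sin (theta_t kp km t) \<noteq> 0"
proof
  assume zero: "kp * sin t + km * sin (theta_t kp km t) = 0"
  define c where "c = kp / km * cos t"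
  have c: "- 1 \<le> c" "c \<le> 1"
    using refracted_cosine_bound[OF k(1,2) t] unfolding c_def by linarith+
  have "sin (theta_t kp km t) = - sin (arccos c)"
    by (simp add: theta_t_eq[OF k(1,2) t] c_def sin_diff)
  then have *: "sin (theta_t kp km t) \<le> 0"
    using sin_ge_zero[OF arccos_lbound[OF c] arccos_ubound[OF c]] by simp
  have "sin (t - pi) \<ge> 0"
    using t theta_c_bounds[OF k(1,2)] by (intro sin_ge_zero) (auto simp: arc_minus_def)
  then have **: "sin t \<le> 0"
    by (simp add: sin_diff)
  have "kp * sin t \<le> 0" "km * sin (theta_t kp km t) \<le> 0"
    using * ** k by (auto intro: mult_nonneg_nonpos)
  then have "kp * sin t = 0" "km * sin (theta_t kp km t) = 0"
    using zero by linarith+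
  then have "sin t = 0" "sin (theta_t kp km t) = 0"
    using k by simp_all
  then have "sin (arccos c) = 0" "(cos t)\<^sup>2 = 1"
    using \<open>sin (theta_t kp km t) = - sin (arccos c)\<close> sin_cos_squared_add[of t] by simp_all
  then have "c\<^sup>2 = 1"
    using sin_cos_squared_add[of "arccos c"] by (simp add: cos_arccos[OF c])
  then have "(kp / km)\<^sup>2 = 1"
    using \<open>(cos t)\<^sup>2 = 1\<close> unfolding c_def power_mult_distrib by simp
  then show False
    using k by (simp add: power2_eq_1_iff field_simps)
qed

lemma plane_wave_add: "plane_wave k d (x + y) = plane_wave k d x * plane_wave k d y"
  by (simp add: plane_wave_def inner_add_left distrib_left exp_add)

lemma transmitted_uminus: "transmitted kp km (- z) t = cnj (transmitted kp km z t)"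
  by (simp add: transmitted_def plane_wave_def exp_cnj)

lemma transmitted_mult:
  "transmitted kp km x t * transmitted kp km y t =
    of_real ((T_coeff kp km t)\<^sup>2) * plane_wave km (dir_t kp km t) (x + y)"
  by (simp add: transmitted_def plane_wave_add power2_eq_square)

lemma continuous_on_transmitted:
  assumes k: "kp > 0" "km > 0" "kp \<noteq> km"
  shows "continuous_on (arc_minus kp km \<times> S) (\<lambda>(t, x). transmitted kp km x t)"
proof -
  have fst: "continuous_on (arc_minus kp km \<times> S) (\<lambda>z. theta_t kp km (fst z))"
    by (rule continuous_on_compose2[OF continuous_on_theta_t[OF k(1,2)] continuous_on_fst[OF continuous_on_id]])
      (simp add: image_subset_iff)
  show ?thesis
    unfolding transmitted_def T_coeff_def plane_wave_def dir_t_def case_prod_unfold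
    by (intro continuous_intros fst) (simp add: mem_Times_iff transmission_denominator_nonzero[OF k])
qed

lemma continuous_on_transmitted_angle:
  assumes k: "kp > 0" "km > 0" "kp \<noteq> km"
  shows "continuous_on (arc_minus kp km) (transmitted kp km x)"
proof -
  have "continuous_on (arc_minus kp km) (\<lambda>t. (\<lambda>(t, x). transmitted kp km x t) (t, x))"
    by (rule continuous_on_compose2[OF continuous_on_transmitted[OF k, of "{x}"]])
      (auto intro!: continuous_intros)
  then show ?thesis
    by simp
qed

section \<open>Integrals depending on a direction, and the intensity identity\<close>

lemma LINT_continuous_eq_integral:
  fixes f :: "real \<Rightarrow> complex"
  assumes "continuous_on {a..b} f"
  shows "(LINT t:{a..b}|lborel. f t) = integral {a..b} f"
  by (rule set_borel_integral_eq_integral(2)[OF borel_integrable_atLeastAtMost'[OF assms]])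

lemma LINT_parameter:
  fixes H :: "real \<Rightarrow> real \<Rightarrow> complex"
  assumes cont: "continuous_on (U \<times> {a..b}) (\<lambda>(s, t). H s t)"
    and bdd: "\<And>s t. s \<in> U \<Longrightarrow> t \<in> {a..b} \<Longrightarrow> norm (H s t) \<le> B"
    and "a \<le> b"
  shows "continuous_on U (\<lambda>s. LINT t:{a..b}|lborel. H s t)"
    and "\<And>s. s \<in> U \<Longrightarrow> norm (LINT t:{a..b}|lborel. H s t) \<le> B * (b - a)"
proof -
  have section_cont: "continuous_on {a..b} (H s)" if "s \<in> U" for s
    using continuous_on_compose2[OF cont, of "{a..b}" "\<lambda>t. (s, t)"] that
    by (simp add: image_subset_iff continuous_on_Pair)
  have "continuous_on U (\<lambda>s. integral {a..b} (H s))"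
    using integral_continuous_on_param[of U a b H] cont by simp
  then show "continuous_on U (\<lambda>s. LINT t:{a..b}|lborel. H s t)"
    by (rule continuous_on_eq) (simp add: LINT_continuous_eq_integral section_cont)
  show "norm (LINT t:{a..b}|lborel. H s t) \<le> B * (b - a)" if "s \<in> U" for s
    unfolding LINT_continuous_eq_integral[OF section_cont[OF that]]
    by (rule integral_bound[OF \<open>a \<le> b\<close> section_cont[OF that] bdd[OF that]])
qed

text \<open>The zeros at the end points account for a function that is continuous only on the open
interval, such as a far-field pattern, which is set to \<open>0\<close> at grazing directions.\<close>

lemma set_integrable_continuous_bounded:
  fixes g :: "real \<Rightarrow> complex"
  assumes cont: "continuous_on {a<..<b} g"
    and bdd: "\<And>t. t \<in> {a<..<b} \<Longrightarrow> norm (g t) \<le> B"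
    and ends: "g a = 0" "g b = 0"
    and sub: "{c..d} \<subseteq> {a..b}"
  shows "set_integrable lborel {c..d} g"
proof -
  define h where "h t = indicat_real {a<..<b} t *\<^sub>R g t" for t
  have meas: "h \<in> borel_measurable borel"
    unfolding h_def[abs_def] by (rule borel_measurable_continuous_on_indicator[OF _ cont]) simp
  have g_eq: "g t = h t" if "t \<in> {c..d}" for t
  proof -
    have "t \<in> {a..b}"
      using that sub by blast
    then have "t = a \<or> t = b \<or> t \<in> {a<..<b}"
      by auto
    then show ?thesis
      using ends by (auto simp: h_def)
  qed
  have "norm (h t) \<le> max B 0" for t
    using bdd[of t] by (auto simp: h_def indicator_def)
  then have "set_integrable lborel {c..d} h"
    unfolding set_integrable_def
    by (intro integrableI_bounded_set_indicator[where B = "max B 0"])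
      (use meas in \<open>simp_all add: emeasure_lborel_Icc_eq\<close>)
  then show ?thesis
    by (subst set_integrable_cong[OF refl refl g_eq])
qed

text \<open>With \<open>a\<close> the pattern and \<open>p\<close> the weight, expanding \<open>|a t1 + a t2|\<^sup>2\<close>
gives four products of a function of \<open>t1\<close> and a function of \<open>t2\<close>. The two mixed ones
integrate to \<open>J (a p)\<close> and \<open>J (a (cnj p))\<close>, each times its own conjugate.\<close>

lemma four_intensity_identity:
  fixes a p :: "real \<Rightarrow> complex"
  assumes a: "continuous_on {\<alpha>..\<beta>} a" and p: "continuous_on {\<alpha>..\<beta>} p"
  defines "J \<equiv> \<lambda>f :: real \<Rightarrow> complex. LINT t:{\<alpha>..\<beta>}|lborel. f t"
  shows "J (\<lambda>t2. J (\<lambda>t1. of_real ((cmod (a t1 + a t2))\<^sup>2) * p t1 * cnj (p t2))) =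
    J (\<lambda>t. cnj (p t)) * J (\<lambda>t. of_real ((cmod (a t))\<^sup>2) * p t)
    + J p * J (\<lambda>t. of_real ((cmod (a t))\<^sup>2) * cnj (p t))
    + of_real ((cmod (J (\<lambda>t. a t * p t)))\<^sup>2) + of_real ((cmod (J (\<lambda>t. a t * cnj (p t))))\<^sup>2)"
proof -
  have add: "J (\<lambda>t. f t + g t) = J f + J g"
    if "continuous_on {\<alpha>..\<beta>} f" "continuous_on {\<alpha>..\<beta>} g" for f g
    unfolding J_def using that by (intro set_integral_add borel_integrable_atLeastAtMost')
  have mult: "J (\<lambda>t. c * f t) = c * J f" for c f
    unfolding J_def by simp
  have cnj: "J (\<lambda>t. cnj (f t)) = cnj (J f)" for f
    unfolding J_def set_lebesgue_integral_def
    by (subst Bochner_Integration.integral_cnj[symmetric]) (simp add: scaleR_conv_of_real)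
  define P where "P t = of_real ((cmod (a t))\<^sup>2) * p t" for t
  define Q where "Q t = of_real ((cmod (a t))\<^sup>2) * cnj (p t)" for t
  define V where "V t = a t * p t" for t
  define W where "W t = a t * cnj (p t)" for t
  have cont: "continuous_on {\<alpha>..\<beta>} P" "continuous_on {\<alpha>..\<beta>} Q"
    "continuous_on {\<alpha>..\<beta>} V" "continuous_on {\<alpha>..\<beta>} W"
    unfolding P_def Q_def V_def W_def by (intro continuous_intros a p)+
  have inner: "J (\<lambda>t1. of_real ((cmod (a t1 + a t2))\<^sup>2) * p t1 * cnj (p t2)) =
      J P * cnj (p t2) + (J p * Q t2 + (J V * cnj (V t2) + cnj (J W) * W t2))" for t2
  proof -
    have expand: "(\<lambda>t1. of_real ((cmod (a t1 + a t2))\<^sup>2) * p t1 * cnj (p t2)) =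
      (\<lambda>t. cnj (p t2) * P t + (Q t2 * p t + (cnj (V t2) * V t + W t2 * cnj (W t))))"
      unfolding P_def Q_def V_def W_def complex_norm_square fun_eq_iff by (simp add: algebra_simps)
    have "J (\<lambda>t1. of_real ((cmod (a t1 + a t2))\<^sup>2) * p t1 * cnj (p t2)) =
      cnj (p t2) * J P + (Q t2 * J p + (cnj (V t2) * J V + W t2 * cnj (J W)))"
      unfolding expand
      by (simp only: add mult cnj continuous_on_add continuous_on_mult continuous_on_const
          continuous_on_cnj cont p)
    then show ?thesis
      by (simp add: mult.commute)
  qed
  have "J (\<lambda>t2. J (\<lambda>t1. of_real ((cmod (a t1 + a t2))\<^sup>2) * p t1 * cnj (p t2))) =
      J P * J (\<lambda>t. cnj (p t)) + (J p * J Q + (J V * cnj (J V) + cnj (J W) * J W))"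
    unfolding inner
    by (simp only: add mult cnj continuous_on_add continuous_on_mult continuous_on_const
        continuous_on_cnj cont p)
  also have "\<dots> = J (\<lambda>t. cnj (p t)) * J P + J p * J Q
      + of_real ((cmod (J V))\<^sup>2) + of_real ((cmod (J W))\<^sup>2)"
    unfolding complex_norm_square by (simp add: algebra_simps)
  finally show ?thesis
    unfolding P_def[abs_def] Q_def[abs_def] V_def[abs_def] W_def[abs_def] .
qed

section \<open>The far-field pattern as a bounded functional of the boundary data\<close>

type_synonym data = "(real ^ 2) \<Rightarrow>\<^sub>C complex"

text \<open>The part of the setting on which the analysis rests: the obstacle stays away from the interface
and from infinity, the problem is well posed, and every solution has a far-field pattern.\<close>

locale two_layered_scattering =
  fixes D :: "(real ^ 2) set" and kp km :: real
  assumes wave_numbers: "kp > 0" "km > 0" "kp \<noteq> km"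
    and obstacle: "bounded D" "closure D \<subseteq> lower"
    and well_posed: "well_posed D kp km"
    and far_field: "\<And>f u. scattering_solution D kp km f u \<Longrightarrow> \<exists>U. is_far_field_pattern kp u U"
begin

abbreviation field :: "(real ^ 2 \<Rightarrow> complex) \<Rightarrow> real ^ 2 \<Rightarrow> complex" where
  "field \<equiv> scattered_field D kp km"

abbreviation pattern :: "(real ^ 2 \<Rightarrow> complex) \<Rightarrow> real ^ 2 \<Rightarrow> complex" where
  "pattern f \<equiv> far_field_pattern kp (field f)"

lemma frontier_in_lower: "x \<in> frontier D \<Longrightarrow> x \<in> lower"
  using obstacle(2) by (auto simp: frontier_def)

lemma outside_obstacle: "x \<notin> lower \<Longrightarrow> x \<in> - D"
  using obstacle(2) closure_subset by blast

lemma field_is_solution: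
  assumes "continuous_on (frontier D) f"
  shows "scattering_solution D kp km f (field f)"
proof -
  have "\<exists>u. scattering_solution D kp km f u"
    using well_posed assms unfolding well_posed_def by blast
  then show ?thesis
    unfolding scattered_field_def by (rule someI_ex)
qed

lemma field_cong:
  assumes "\<And>x. x \<in> frontier D \<Longrightarrow> f x = g x"
  shows "field f = field g"
proof -
  have "scattering_solution D kp km f = scattering_solution D kp km g"
    using assms by (auto simp: scattering_solution_def fun_eq_iff)
  then show ?thesis
    by (simp add: scattered_field_def)
qed

lemma pattern_is_far_field_pattern:
  assumes "continuous_on (frontier D) f"
  shows "is_far_field_pattern kp (field f) (pattern f)"
proof -
  obtain U where U: "is_far_field_pattern kp (field f) U"
    using far_field[OF field_is_solution[OF assms]] by blast
  then show ?thesis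
    by (rule is_far_field_pattern_cong) (simp_all add: far_field_pattern_eq[OF U])
qed

lemma pattern_eq_0:
  assumes "continuous_on (frontier D) f" "y \<notin> upper"
  shows "pattern f y = 0"
  using far_field_pattern_eq[OF pattern_is_far_field_pattern[OF assms(1)]] assms(2) by metis

lemma field_lincomb:
  assumes f: "continuous_on (frontier D) f" and g: "continuous_on (frontier D) g"
    and x: "x \<in> - D"
  shows "field (\<lambda>x. a * f x + b * g x) x = a * field f x + b * field g x"
proof -
  have "scattering_solution D kp km (\<lambda>x. a * f x + b * g x) (\<lambda>x. a * field f x + b * field g x)"
    by (rule scattering_solution_lincomb[OF obstacle field_is_solution[OF f] field_is_solution[OF g]]) simp
  moreover have "scattering_solution D kp km (\<lambda>x. a * f x + b * g x) (field (\<lambda>x. a * f x + b * g x))"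
    by (intro field_is_solution continuous_intros f g)
  ultimately show ?thesis
    using well_posed x unfolding well_posed_def by blast
qed

text \<open>The linear combination of the solutions agrees with the solution for the combined data outside
the obstacle, hence in the upper half-plane, where the far field is read off.\<close>

lemma pattern_lincomb:
  assumes f: "continuous_on (frontier D) f" and g: "continuous_on (frontier D) g"
    and y: "norm y = 1" "y \<in> upper"
  shows "pattern (\<lambda>x. a * f x + b * g x) y = a * pattern f y + b * pattern g y"
proof -
  let ?h = "\<lambda>x. a * f x + b * g x"
  have "is_far_field_pattern kp (\<lambda>x. a * field f x + b * field g x) (\<lambda>y. a * pattern f y + b * pattern g y)"
    by (intro is_far_field_pattern_lincomb pattern_is_far_field_pattern f g)
  then have "is_far_field_pattern kp (field ?h) (\<lambda>y. a * pattern f y + b * pattern g y)"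
    by (rule is_far_field_pattern_cong)
      (simp_all add: field_lincomb[OF f g outside_obstacle] upper_def lower_def)
  moreover have "is_far_field_pattern kp (field ?h) (pattern ?h)"
    by (intro pattern_is_far_field_pattern continuous_intros f g)
  ultimately show ?thesis
    using far_field_pattern_unique y by blast
qed

lemma linear_field:
  assumes "x \<in> - D"
  shows "linear (\<lambda>F :: data. field (apply_bcontfun F) x)"
proof
  fix F G :: "data" and c :: real
  show "field (apply_bcontfun (F + G)) x = field (apply_bcontfun F) x + field (apply_bcontfun G) x"
    using field_lincomb[OF _ _ assms, of "apply_bcontfun F" "apply_bcontfun G" 1 1] by simp
  show "field (apply_bcontfun (c *\<^sub>R F)) x = c *\<^sub>R field (apply_bcontfun F) x"
    using field_lincomb[OF _ _ assms, of "apply_bcontfun F" "apply_bcontfun F" "of_real c" 0] by (simp add: scaleR_conv_of_real)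
qed

lemma linear_pattern:
  assumes "norm y = 1" "y \<in> upper"
  shows "linear (\<lambda>F :: data. pattern (apply_bcontfun F) y)"
proof
  fix F G :: "data" and c :: real
  show "pattern (apply_bcontfun (F + G)) y = pattern (apply_bcontfun F) y + pattern (apply_bcontfun G) y"
    using pattern_lincomb[OF _ _ assms, of "apply_bcontfun F" "apply_bcontfun G" 1 1] by simp
  show "pattern (apply_bcontfun (c *\<^sub>R F)) y = c *\<^sub>R pattern (apply_bcontfun F) y"
    using pattern_lincomb[OF _ _ assms, of "apply_bcontfun F" "apply_bcontfun F" "of_real c" 0] by (simp add: scaleR_conv_of_real)
qed

text \<open>This is continuous dependence on the data, used for the compact set \<open>{x}\<close>.\<close>

lemma continuous_on_field:
  assumes "x \<in> - D"
  shows "continuous_on UNIV (\<lambda>F :: data. field (apply_bcontfun F) x)"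
  unfolding continuous_on_sequentially comp_def
proof safe
  fix F :: "nat \<Rightarrow> data" and G assume "F \<longlonglongrightarrow> G"
  then have "uniform_limit (frontier D) (\<lambda>n. apply_bcontfun (F n)) (apply_bcontfun G) sequentially"
    using tendsto_bcontfun_uniform_limit uniform_limit_on_subset by blast
  then have "uniform_limit {x} (\<lambda>n. field (apply_bcontfun (F n))) (field (apply_bcontfun G)) sequentially"
    by (rule well_posed[unfolded well_posed_def, THEN conjunct2, THEN conjunct2, rule_format, rotated 2])
      (use assms in \<open>auto intro: field_is_solution\<close>)
  then show "(\<lambda>n. field (apply_bcontfun (F n)) x) \<longlonglongrightarrow> field (apply_bcontfun G) x"
    by (rule tendsto_uniform_limitI) simp
qed

text \<open>The pattern at \<open>y\<close> is a pointwise limit of evaluations of the rescaled solution along the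
ray through \<open>y\<close>. These are continuous functionals and, being convergent, pointwise bounded;
so the Banach-Steinhaus theorem bounds them, and with them their limit, by a common constant.\<close>

lemma bounded_linear_pattern:
  assumes y: "norm y = 1" "y \<in> upper"
  shows "bounded_linear (\<lambda>F :: data. pattern (apply_bcontfun F) y)"
proof -
  let ?L = "\<lambda>n (F :: data). rescaled kp (real n) (field (apply_bcontfun F)) y"
  have ray: "real n *\<^sub>R y \<in> - D" for n
    using y(2) by (intro outside_obstacle) (simp add: upper_def lower_def not_less)
  have lim: "(\<lambda>n. ?L n F) \<longlonglongrightarrow> pattern (apply_bcontfun F) y" for F
    by (rule filterlim_compose[OF rescaled_tendsto[OF pattern_is_far_field_pattern y]
          filterlim_real_sequentially]) simp
  obtain C where C: "\<And>n F. norm (?L n F) \<le> C * norm F"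
  proof -
    have "\<exists>C>0. \<forall>n\<in>UNIV. \<forall>F. norm (?L n F) \<le> C * norm F"
    proof (rule uniform_boundedness)
      show "linear (?L n)" for n
        unfolding rescaled_def
        by (rule linear_compose[OF linear_field[OF ray] bounded_linear.linear[OF bounded_linear_mult_right],
              unfolded o_def])
      show "continuous_on UNIV (?L n)" for n
        unfolding rescaled_def by (intro continuous_intros continuous_on_field ray)
      show "\<exists>M. \<forall>n\<in>UNIV. norm (?L n F) \<le> M" for F
        using convergent_imp_Bseq[OF convergentI[OF lim[of F]]] unfolding Bseq_def by blast
    qed
    then show ?thesis
      using that by blast
  qed
  have "norm (pattern (apply_bcontfun F) y) \<le> norm F * C" for F :: "data"
  proof (rule tendsto_upperbound[OF tendsto_norm[OF lim[of F]]])
    show "\<forall>\<^sub>F n in sequentially. norm (?L n F) \<le> norm F * C"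
      by (intro always_eventually allI) (subst mult.commute, rule C)
  qed simp
  then show ?thesis
    by (rule bounded_linear_intro[OF linear_add[OF linear_pattern[OF y]]
          linear_scale[OF linear_pattern[OF y]]])
qed

text \<open>On the open half-circle the pattern is the uniform limit of the rescaled solution on growing
half-circles. The latter is continuous up to the end points of a half-circle, hence bounded, which
by uniform convergence bounds the pattern as well.\<close>

lemma continuous_bounded_pattern:
  fixes F :: "data"
  shows "continuous_on {0<..<pi} (\<lambda>\<phi>. pattern (apply_bcontfun F) (dir \<phi>))"
    and "\<exists>M. \<forall>\<phi>\<in>{0<..<pi}. norm (pattern (apply_bcontfun F) (dir \<phi>)) \<le> M"
proof -
  let ?u = "field (apply_bcontfun F)" and ?U = "pattern (apply_bcontfun F)"
  have sol: "scattering_solution D kp km (apply_bcontfun F) ?u"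
    and ff: "is_far_field_pattern kp ?u ?U"
    by (rule field_is_solution, simp) (rule pattern_is_far_field_pattern, simp)
  have cont: "continuous_on {0..pi} (\<lambda>\<phi>. rescaled kp r ?u (dir \<phi>))" if "r \<ge> 0" for r
  proof -
    have "continuous_on (- D) ?u"
      using sol unfolding scattering_solution_def by blast
    moreover have "continuous_on {0..pi} (\<lambda>\<phi>. r *\<^sub>R dir \<phi>)"
      by (intro continuous_on_scaleR continuous_on_const continuous_on_dir continuous_on_id)
    moreover have "r *\<^sub>R dir \<phi> \<in> - D" if "\<phi> \<in> {0..pi}" for \<phi>
      using that \<open>r \<ge> 0\<close>
      by (intro outside_obstacle) (simp add: lower_def dir_def not_less sin_ge_zero)
    ultimately have "continuous_on {0..pi} (\<lambda>\<phi>. ?u (r *\<^sub>R dir \<phi>))"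
      using continuous_on_compose2 image_subsetI by metis
    then show ?thesis
      unfolding rescaled_def by (intro continuous_on_mult continuous_on_const)
  qed
  have close: "\<exists>R>0. \<forall>r\<ge>R. \<forall>\<phi>\<in>{0<..<pi}.
      norm (rescaled kp r ?u (dir \<phi>) - ?U (dir \<phi>)) \<le> e" if e: "e > 0" for e
  proof -
    obtain R where "R > 0"
      "\<forall>r\<ge>R. \<forall>y. norm y = 1 \<longrightarrow> y \<in> upper \<longrightarrow> cmod (rescaled kp r ?u y - ?U y) \<le> e"
      using rescaled_converges_uniformly[OF ff e] by blast
    moreover have "norm (dir \<phi>) = 1" "dir \<phi> \<in> upper" if "\<phi> \<in> {0<..<pi}" for \<phi>
      using that by (simp_all add: dir_in_upper)
    ultimately show ?thesis
      by blast
  qed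
  have limit: "uniform_limit {0<..<pi} (\<lambda>r \<phi>. rescaled kp r ?u (dir \<phi>)) (\<lambda>\<phi>. ?U (dir \<phi>)) at_top"
  proof (rule uniform_limitI)
    fix e :: real assume "e > 0"
    then obtain R where "\<forall>r\<ge>R. \<forall>\<phi>\<in>{0<..<pi}.
        norm (rescaled kp r ?u (dir \<phi>) - ?U (dir \<phi>)) \<le> e / 2"
      using close[of "e / 2"] by auto
    then show "\<forall>\<^sub>F r in at_top. \<forall>\<phi>\<in>{0<..<pi}.
        dist (rescaled kp r ?u (dir \<phi>)) (?U (dir \<phi>)) < e"
      using \<open>e > 0\<close> by (intro eventually_at_top_linorderI[of R]) (force simp: dist_norm)
  qed
  have approx: "\<forall>\<^sub>F r in at_top. continuous_on {0<..<pi} (\<lambda>\<phi>. rescaled kp r ?u (dir \<phi>))"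
    by (intro eventually_at_top_linorderI[of 0])
      (rule continuous_on_subset[OF cont greaterThanLessThan_subseteq_atLeastAtMost_iff[THEN iffD2]], auto)
  show "continuous_on {0<..<pi} (\<lambda>\<phi>. ?U (dir \<phi>))"
    by (rule uniform_limit_theorem[OF approx limit]) simp
  obtain R where R: "R > 0" "\<forall>\<phi>\<in>{0<..<pi}.
      norm (rescaled kp R ?u (dir \<phi>) - ?U (dir \<phi>)) \<le> 1"
    using close[of 1] zero_less_one by blast
  have "bounded ((\<lambda>\<phi>. rescaled kp R ?u (dir \<phi>)) ` {0..pi})"
    using R(1) by (intro compact_imp_bounded compact_continuous_image cont compact_Icc less_imp_le)
  then obtain M where M: "\<forall>z\<in>(\<lambda>\<phi>. rescaled kp R ?u (dir \<phi>)) ` {0..pi}. norm z \<le> M"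
    unfolding bounded_iff by (elim exE)
  have "norm (?U (dir \<phi>)) \<le> M + 1" if \<phi>: "\<phi> \<in> {0<..<pi}" for \<phi>
  proof -
    have "norm (rescaled kp R ?u (dir \<phi>)) \<le> M"
      by (rule bspec[OF M imageI]) (use \<phi> in simp)
    moreover have "norm (rescaled kp R ?u (dir \<phi>) - ?U (dir \<phi>)) \<le> 1"
      using R(2) \<phi> by blast
    ultimately show ?thesis
      using norm_triangle_sub[of "?U (dir \<phi>)" "rescaled kp R ?u (dir \<phi>)"]
      by (simp add: norm_minus_commute)
  qed
  then show "\<exists>M. \<forall>\<phi>\<in>{0<..<pi}. norm (?U (dir \<phi>)) \<le> M"
    by blast
qed

lemma pattern_uniformly_bounded:
  "\<exists>C>0. \<forall>\<phi>\<in>{0<..<pi}. \<forall>F :: data. norm (pattern (apply_bcontfun F) (dir \<phi>)) \<le> C * norm F"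
proof (rule uniform_boundedness)
  fix \<phi> assume "\<phi> \<in> {0<..<pi}"
  then have bl: "bounded_linear (\<lambda>F :: data. pattern (apply_bcontfun F) (dir \<phi>))"
    by (intro bounded_linear_pattern) (simp_all add: dir_in_upper)
  then show "linear (\<lambda>F :: data. pattern (apply_bcontfun F) (dir \<phi>))"
    by (rule bounded_linear.linear)
  show "continuous_on UNIV (\<lambda>F :: data. pattern (apply_bcontfun F) (dir \<phi>))"
    by (rule linear_continuous_on[OF bl])
qed (rule continuous_bounded_pattern)

text \<open>The dependence on \<open>t\<close> is uniform in \<open>\<phi>\<close> because of the uniform bound on the
pattern functionals; continuity in \<open>\<phi>\<close> is then only needed for one value of \<open>t\<close>.\<close>

lemma pattern_jointly_continuous:
  fixes h :: "real \<Rightarrow> data"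
  assumes h: "continuous_on T h"
  shows "continuous_on ({0<..<pi} \<times> T) (\<lambda>(\<phi>, t). pattern (apply_bcontfun (h t)) (dir \<phi>))"
proof -
  obtain C where C: "\<forall>\<phi>\<in>{0<..<pi}. \<forall>F :: data.
      norm (pattern (apply_bcontfun F) (dir \<phi>)) \<le> C * norm F"
    using pattern_uniformly_bounded by blast
  show ?thesis
    unfolding continuous_on_def
  proof
    fix z0 assume "z0 \<in> {0<..<pi} \<times> T"
    then obtain \<phi>0 t0 where z0: "z0 = (\<phi>0, t0)" and \<phi>0: "\<phi>0 \<in> {0<..<pi}" and t0: "t0 \<in> T"
      by blast
    let ?F = "at (\<phi>0, t0) within {0<..<pi} \<times> T"
    have "isCont (\<lambda>\<phi>. pattern (apply_bcontfun (h t0)) (dir \<phi>)) \<phi>0"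
      using continuous_bounded_pattern(1)[of "h t0"] \<phi>0
      by (simp only: continuous_on_eq_continuous_at[OF open_greaterThanLessThan])
    then have at_t0: "((\<lambda>z. pattern (apply_bcontfun (h t0)) (dir (fst z)))
        \<longlongrightarrow> pattern (apply_bcontfun (h t0)) (dir \<phi>0)) ?F"
      by (rule isCont_tendsto_compose) (rule tendsto_fst[OF tendsto_ident_at, of "(\<phi>0, t0)", simplified])
    have diff: "((\<lambda>z. pattern (apply_bcontfun (h (snd z))) (dir (fst z))
        - pattern (apply_bcontfun (h t0)) (dir (fst z))) \<longlongrightarrow> 0) ?F"
    proof (rule Lim_null_comparison)
      have "norm (pattern (apply_bcontfun (h t)) (dir \<phi>) - pattern (apply_bcontfun (h t0)) (dir \<phi>))
          \<le> C * norm (h t - h t0)"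
        if "\<phi> \<in> {0<..<pi}" for \<phi> t
      proof -
        have "linear (\<lambda>F :: data. pattern (apply_bcontfun F) (dir \<phi>))"
          using that by (intro linear_pattern) (simp_all add: dir_in_upper)
        from linear_diff[OF this, of "h t" "h t0"]
        have "pattern (apply_bcontfun (h t)) (dir \<phi>) - pattern (apply_bcontfun (h t0)) (dir \<phi>) =
            pattern (apply_bcontfun (h t - h t0)) (dir \<phi>)"
          by (rule sym)
        also have "norm \<dots> \<le> C * norm (h t - h t0)"
          using C that by blast
        finally show ?thesis .
      qed
      then show "\<forall>\<^sub>F z in ?F. norm (pattern (apply_bcontfun (h (snd z))) (dir (fst z))
          - pattern (apply_bcontfun (h t0)) (dir (fst z))) \<le> C * norm (h (snd z) - h t0)"
        unfolding eventually_at_filter by (intro always_eventually) (simp add: mem_Times_iff)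
      have h_snd: "continuous_on ({0<..<pi} \<times> T) (\<lambda>z. h (snd z))"
        by (rule continuous_on_compose2[OF h continuous_on_snd[OF continuous_on_id]]) (simp add: image_subset_iff)
      have "((\<lambda>z. h (snd z)) \<longlongrightarrow> h t0) ?F"
        using bspec[OF h_snd[unfolded continuous_on_def], of "(\<phi>0, t0)"] \<phi>0 t0 by simp
      then show "((\<lambda>z. C * norm (h (snd z) - h t0)) \<longlongrightarrow> 0) ?F"
        by (intro tendsto_mult_right_zero tendsto_norm_zero LIM_zero)
    qed
    show "((\<lambda>(\<phi>, t). pattern (apply_bcontfun (h t)) (dir \<phi>)) \<longlongrightarrow>
        (case z0 of (\<phi>, t) \<Rightarrow> pattern (apply_bcontfun (h t)) (dir \<phi>))) (at z0 within {0<..<pi} \<times> T)"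
      using tendsto_add[OF diff at_t0] by (simp add: case_prod_unfold z0)
  qed
qed

section \<open>Superposition of incident waves, and the imaging function\<close>

text \<open>Integration over all directions of incidence.\<close>

abbreviation J :: "(real \<Rightarrow> complex) \<Rightarrow> complex" where
  "J f \<equiv> LINT t:arc_minus kp km|lborel. f t"

lemma background_field_eq_transmitted:
  assumes "x \<in> frontier D"
  shows "background_field kp km t x = transmitted kp km x t"
  using frontier_in_lower[OF assms] by (simp add: background_field_def transmitted_def upper_def lower_def)

lemma continuous_on_background_field: "continuous_on (frontier D) (background_field kp km t)"
proof -
  have "continuous_on (frontier D) (\<lambda>x. transmitted kp km x t)"
    unfolding transmitted_def plane_wave_def by (intro continuous_intros)
  then show ?thesis
    by (rule continuous_on_eq) (simp add: background_field_eq_transmitted)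
qed

text \<open>The weighted incident waves as a continuous curve in the space of boundary data. Below the
interface the background field is the transmitted wave, and its formula is continuous on the whole
plane; this provides the extension to a box around the obstacle.\<close>

lemma incident_family:
  assumes c: "continuous_on (arc_minus kp km) c"
  obtains h :: "real \<Rightarrow> data"
  where "continuous_on (arc_minus kp km) h"
    and "\<And>t x. t \<in> arc_minus kp km \<Longrightarrow> x \<in> frontier D \<Longrightarrow>
      apply_bcontfun (h t) x = - (transmitted kp km x t * c t)"
    and "\<And>t y. t \<in> arc_minus kp km \<Longrightarrow> norm y = 1 \<Longrightarrow> y \<in> upper \<Longrightarrow>
      pattern (apply_bcontfun (h t)) y = u_inf D kp km y t * c t"
proof -
  have "bounded (frontier D)"
    unfolding frontier_def by (rule bounded_diff[OF bounded_closure[OF obstacle(1)]])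
  then obtain a where box: "frontier D \<subseteq> cbox (- a) a"
    using bounded_subset_cbox_symmetric by blast
  have "continuous_on (arc_minus kp km \<times> cbox (- a) a) (\<lambda>z. c (fst z))"
    by (rule continuous_on_compose2[OF c continuous_on_fst[OF continuous_on_id]])
      (simp add: image_subset_iff)
  then have "continuous_on (arc_minus kp km \<times> cbox (- a) a)
      (\<lambda>(t, x). - (transmitted kp km x t * c t))"
    using continuous_on_transmitted[OF wave_numbers, of "cbox (- a) a"]
    unfolding case_prod_unfold by (intro continuous_on_minus continuous_on_mult)
  then obtain h where cont: "continuous_on (arc_minus kp km) h"
    and h: "\<And>t x. t \<in> arc_minus kp km \<Longrightarrow> x \<in> cbox (- a) a \<Longrightarrow>
      apply_bcontfun (h t) x = - (transmitted kp km x t * c t)"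
    by (rule curried_continuous_bcontfun) blast
  have h_frontier: "apply_bcontfun (h t) x = - (transmitted kp km x t * c t)"
    if "t \<in> arc_minus kp km" "x \<in> frontier D" for t x
    using h[OF that(1) subsetD[OF box that(2)]] .
  have "pattern (apply_bcontfun (h t)) y = u_inf D kp km y t * c t"
    if "t \<in> arc_minus kp km" "norm y = 1" "y \<in> upper" for t y
  proof -
    have "field (apply_bcontfun (h t)) = field (\<lambda>x. c t * (- background_field kp km t x) + 0 * 0)"
      by (rule field_cong) (simp add: h_frontier that(1) background_field_eq_transmitted)
    then show ?thesis
      using pattern_lincomb[of "\<lambda>x. - background_field kp km t x" "\<lambda>x. 0" y "c t" 0] that
      by (simp add: u_inf_def continuous_on_background_field continuous_on_minus mult.commute)
  qed
  then show thesis
    using that cont h_frontier by blast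
qed

lemma arc_minus_nonempty: "pi + theta_c kp km \<le> 2 * pi - theta_c kp km"
  using theta_c_bounds[OF wave_numbers(1,2)] by simp

text \<open>The boundary data is the integral of the curve from \<open>incident_family\<close>. Evaluation at a point
and the pattern in a given direction are both bounded functionals, so both commute with this
integral.\<close>

lemma superposition:
  assumes c: "continuous_on (arc_minus kp km) c"
    and f: "\<And>x. x \<in> frontier D \<Longrightarrow> f x = - J (\<lambda>t. transmitted kp km x t * c t)"
  shows "scattering_solution D kp km f (field f)"
    and "is_far_field_pattern kp (field f) (\<lambda>y. J (\<lambda>t. u_inf D kp km y t * c t))"
proof -
  obtain h :: "real \<Rightarrow> data"
    where cont: "continuous_on (arc_minus kp km) h"
    and h: "\<And>t x. t \<in> arc_minus kp km \<Longrightarrow> x \<in> frontier D \<Longrightarrow>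
      apply_bcontfun (h t) x = - (transmitted kp km x t * c t)"
    and pat: "\<And>t y. t \<in> arc_minus kp km \<Longrightarrow> norm y = 1 \<Longrightarrow> y \<in> upper \<Longrightarrow>
      pattern (apply_bcontfun (h t)) y = u_inf D kp km y t * c t"
    using incident_family[OF c] by blast
  have int: "h integrable_on arc_minus kp km"
    using integrable_continuous_real cont unfolding arc_minus_def by blast
  define F where "F = integral (arc_minus kp km) h"
  have commute: "L F = J (\<lambda>t. L (h t))" if L: "bounded_linear L" for L
  proof -
    have "continuous_on (arc_minus kp km) (\<lambda>t. L (h t))"
      by (rule bounded_linear.continuous_on[OF L cont])
    then have "J (\<lambda>t. L (h t)) = integral (arc_minus kp km) (L \<circ> h)"
      unfolding arc_minus_def o_def by (rule LINT_continuous_eq_integral)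
    then show ?thesis
      unfolding F_def by (simp only: integral_linear[OF int L])
  qed
  have F: "apply_bcontfun F x = f x" if "x \<in> frontier D" for x
  proof -
    have "bounded_linear (\<lambda>F :: data. apply_bcontfun F x)"
      by (rule bounded_linear_intro[where K = 1]) (simp_all add: norm_bounded)
    then have "apply_bcontfun F x = J (\<lambda>t. apply_bcontfun (h t) x)"
      by (rule commute)
    also have "\<dots> = J (\<lambda>t. - (transmitted kp km x t * c t))"
      by (rule set_lebesgue_integral_cong) (simp_all add: arc_minus_def h[unfolded arc_minus_def] that)
    also have "\<dots> = f x"
      by (simp add: f[OF that] set_lebesgue_integral_def)
    finally show ?thesis .
  qed
  have field_F: "field (apply_bcontfun F) = field f"
    by (rule field_cong) (rule F)
  have cont_f: "continuous_on (frontier D) f"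
    by (rule continuous_on_eq[OF continuous_on_apply_bcontfun F])
  then show "scattering_solution D kp km f (field f)"
    by (rule field_is_solution)
  show "is_far_field_pattern kp (field f) (\<lambda>y. J (\<lambda>t. u_inf D kp km y t * c t))"
  proof (rule is_far_field_pattern_cong[OF pattern_is_far_field_pattern[OF cont_f]])
    fix y :: "real ^ 2" assume y: "norm y = 1" "y \<in> upper"
    have "pattern (apply_bcontfun F) y = J (\<lambda>t. pattern (apply_bcontfun (h t)) y)"
      by (rule commute[OF bounded_linear_pattern[OF y]])
    also have "\<dots> = J (\<lambda>t. u_inf D kp km y t * c t)"
      by (rule set_lebesgue_integral_cong) (simp_all add: arc_minus_def pat[unfolded arc_minus_def] y)
    finally show "pattern f y = J (\<lambda>t. u_inf D kp km y t * c t)"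
      by (simp add: field_F)
  qed simp
qed

lemma u_inf_jointly_continuous_bounded:
  shows "continuous_on ({0<..<pi} \<times> arc_minus kp km) (\<lambda>(\<phi>, t). u_inf D kp km (dir \<phi>) t)"
    and "\<exists>M\<ge>0. \<forall>\<phi>\<in>{0<..<pi}. \<forall>t\<in>arc_minus kp km. cmod (u_inf D kp km (dir \<phi>) t) \<le> M"
proof -
  obtain h :: "real \<Rightarrow> data"
    where cont: "continuous_on (arc_minus kp km) h"
    and pat: "\<And>t y. t \<in> arc_minus kp km \<Longrightarrow> norm y = 1 \<Longrightarrow> y \<in> upper \<Longrightarrow>
      pattern (apply_bcontfun (h t)) y = u_inf D kp km y t * 1"
    by (rule incident_family[OF continuous_on_const[of "arc_minus kp km" 1]]) (rule that)
  show "continuous_on ({0<..<pi} \<times> arc_minus kp km) (\<lambda>(\<phi>, t). u_inf D kp km (dir \<phi>) t)"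
  proof (rule continuous_on_eq[OF pattern_jointly_continuous[OF cont]])
    fix z assume "z \<in> {0<..<pi} \<times> arc_minus kp km"
    then obtain \<phi> t where "z = (\<phi>, t)" "\<phi> \<in> {0<..<pi}" "t \<in> arc_minus kp km"
      by (rule SigmaE)
    then show "(case z of (\<phi>, t) \<Rightarrow> pattern (apply_bcontfun (h t)) (dir \<phi>)) =
        (case z of (\<phi>, t) \<Rightarrow> u_inf D kp km (dir \<phi>) t)"
      using pat[of t "dir \<phi>"] by (simp add: dir_in_upper)
  qed
  have "bounded (h ` arc_minus kp km)"
    using cont unfolding arc_minus_def
    by (intro compact_imp_bounded compact_continuous_image compact_Icc)
  then obtain B where B: "\<forall>F\<in>h ` arc_minus kp km. norm F \<le> B"
    unfolding bounded_iff by (elim exE)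
  obtain C where C: "C > 0" "\<forall>\<phi>\<in>{0<..<pi}. \<forall>F :: data.
      norm (pattern (apply_bcontfun F) (dir \<phi>)) \<le> C * norm F"
    using pattern_uniformly_bounded by (elim exE conjE)
  have "cmod (u_inf D kp km (dir \<phi>) t) \<le> C * max B 0"
    if "\<phi> \<in> {0<..<pi}" "t \<in> arc_minus kp km" for \<phi> t
  proof -
    have "u_inf D kp km (dir \<phi>) t = pattern (apply_bcontfun (h t)) (dir \<phi>)"
      using pat[OF that(2), of "dir \<phi>"] that(1) by (simp add: dir_in_upper)
    also have "norm \<dots> \<le> C * norm (h t)"
      by (rule C(2)[rule_format, OF that(1)])
    also have "\<dots> \<le> C * max B 0"
      using bspec[OF B imageI[OF that(2)]] C(1) by (intro mult_left_mono) auto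
    finally show ?thesis .
  qed
  then show "\<exists>M\<ge>0. \<forall>\<phi>\<in>{0<..<pi}. \<forall>t\<in>arc_minus kp km. cmod (u_inf D kp km (dir \<phi>) t) \<le> M"
    using C(1) by (intro exI[of _ "C * max B 0"] conjI ballI mult_nonneg_nonneg) simp_all
qed

lemma u_inf_horizontal: "u_inf D kp km (dir 0) t = 0" "u_inf D kp km (dir pi) t = 0"
proof -
  have "u_inf D kp km y t = 0" if "y \<notin> upper" for y
    unfolding u_inf_def
    by (rule pattern_eq_0[OF continuous_on_minus[OF continuous_on_background_field] that])
  then show "u_inf D kp km (dir 0) t = 0" "u_inf D kp km (dir pi) t = 0"
    by (simp_all add: upper_def dir_def)
qed

lemma arc_plus_subset: "arc_plus kp km \<subseteq> {0..pi}"
  using theta_c_bounds[OF wave_numbers(1,2)] by (auto simp: arc_plus_def)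

text \<open>For a fixed observation angle this is \<open>four_intensity_identity\<close>; the remaining work is to
show that its four terms are integrable over the observation angle.\<close>

lemma imaging_function_decomposition:
  "imaging_function D kp km z = of_real (I1 D kp km z + I2 D kp km z)"
proof -
  define a where "a \<phi> t = u_inf D kp km (dir \<phi>) t" for \<phi> t
  define p where "p = transmitted kp km (- z)"
  define P where "P g = (LINT \<phi>:arc_plus kp km|lborel. g \<phi>)" for g :: "real \<Rightarrow> complex"
  have cnj_p: "transmitted kp km z t = cnj (p t)" for t
    by (simp add: p_def transmitted_uminus)
  have cont_p: "continuous_on (arc_minus kp km) p"
    unfolding p_def by (rule continuous_on_transmitted_angle[OF wave_numbers])
  have cont_a: "continuous_on ({0<..<pi} \<times> arc_minus kp km) (\<lambda>(\<phi>, t). a \<phi> t)"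
    unfolding a_def by (rule u_inf_jointly_continuous_bounded)
  obtain M where M: "M \<ge> 0" "\<And>\<phi> t. \<phi> \<in> {0<..<pi} \<Longrightarrow> t \<in> arc_minus kp km \<Longrightarrow> cmod (a \<phi> t) \<le> M"
    using u_inf_jointly_continuous_bounded(2) unfolding a_def by (elim exE conjE) blast
  have "bounded (p ` arc_minus kp km)"
    using cont_p unfolding arc_minus_def
    by (intro compact_imp_bounded compact_continuous_image compact_Icc)
  then obtain B where B: "\<forall>w\<in>p ` arc_minus kp km. norm w \<le> B"
    unfolding bounded_iff by (elim exE)
  then have B: "cmod (p t) \<le> max B 0" if "t \<in> arc_minus kp km" for t
    using bspec[OF B imageI[OF that]] by linarith
  have a_horizontal: "a 0 t = 0" "a pi t = 0" for t
    by (simp_all add: a_def u_inf_horizontal)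
  have cont_section: "continuous_on (arc_minus kp km) (a \<phi>)" if "\<phi> \<in> arc_plus kp km" for \<phi>
  proof -
    consider "\<phi> = 0" | "\<phi> = pi" | "\<phi> \<in> {0<..<pi}"
      using arc_plus_subset \<open>\<phi> \<in> arc_plus kp km\<close> by fastforce
    then show ?thesis
    proof cases
      case 3
      then show ?thesis
        using continuous_on_compose2[OF cont_a, of "arc_minus kp km" "\<lambda>t. (\<phi>, t)"]
        by (simp add: image_subset_iff continuous_on_Pair)
    qed (simp_all add: a_horizontal)
  qed
  have param: "continuous_on {0<..<pi} (\<lambda>\<phi>. J (H \<phi>))"
      "\<phi> \<in> {0<..<pi} \<Longrightarrow> cmod (J (H \<phi>)) \<le> N * (pi - 2 * theta_c kp km)"
    if "continuous_on ({0<..<pi} \<times> arc_minus kp km) (\<lambda>(\<phi>, t). H \<phi> t)"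
      "\<And>\<phi> t. \<phi> \<in> {0<..<pi} \<Longrightarrow> t \<in> arc_minus kp km \<Longrightarrow> cmod (H \<phi> t) \<le> N" for H N \<phi>
    using LINT_parameter[OF that[unfolded arc_minus_def] arc_minus_nonempty]
    by (simp_all add: arc_minus_def)
  have integrable: "set_integrable lborel (arc_plus kp km) g"
    if "continuous_on {0<..<pi} g" "\<And>\<phi>. \<phi> \<in> {0<..<pi} \<Longrightarrow> cmod (g \<phi>) \<le> N" "g 0 = 0" "g pi = 0"
    for g :: "real \<Rightarrow> complex" and N
    unfolding arc_plus_def
    by (rule set_integrable_continuous_bounded[OF that arc_plus_subset[unfolded arc_plus_def]])
  have cont_pair: "continuous_on ({0<..<pi} \<times> arc_minus kp km) (\<lambda>z. a (fst z) (snd z))"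
      "continuous_on ({0<..<pi} \<times> arc_minus kp km) (\<lambda>z. p (snd z))"
    subgoal using cont_a by (simp add: case_prod_unfold)
    subgoal by (rule continuous_on_compose2[OF cont_p continuous_on_snd[OF continuous_on_id]])
        (simp add: image_subset_iff)
    done
  have quadratic: "set_integrable lborel (arc_plus kp km) (\<lambda>\<phi>. J (\<lambda>t. of_real ((cmod (a \<phi> t))\<^sup>2) * q t))"
    and linear: "set_integrable lborel (arc_plus kp km) (\<lambda>\<phi>. complex_of_real ((cmod (J (\<lambda>t. a \<phi> t * q t)))\<^sup>2))"
    if q: "continuous_on ({0<..<pi} \<times> arc_minus kp km) (\<lambda>z. q (snd z))"
      "\<And>t. t \<in> arc_minus kp km \<Longrightarrow> cmod (q t) \<le> max B 0" for q
  proof -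
    have "continuous_on ({0<..<pi} \<times> arc_minus kp km) (\<lambda>(\<phi>, t). of_real ((cmod (a \<phi> t))\<^sup>2) * q t)"
      unfolding case_prod_unfold by (intro continuous_intros cont_pair q)
    moreover have "cmod (of_real ((cmod (a \<phi> t))\<^sup>2) * q t) \<le> M\<^sup>2 * max B 0"
      if "\<phi> \<in> {0<..<pi}" "t \<in> arc_minus kp km" for \<phi> t
      unfolding norm_mult norm_of_real abs_power2
      using M q(2) that by (intro mult_mono power_mono) simp_all
    ultimately show "set_integrable lborel (arc_plus kp km) (\<lambda>\<phi>. J (\<lambda>t. of_real ((cmod (a \<phi> t))\<^sup>2) * q t))"
      by (intro integrable[OF param]) (simp_all add: a_horizontal)
    have V: "continuous_on ({0<..<pi} \<times> arc_minus kp km) (\<lambda>(\<phi>, t). a \<phi> t * q t)"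
      unfolding case_prod_unfold by (intro continuous_intros cont_pair q)
    have V_le: "cmod (a \<phi> t * q t) \<le> M * max B 0"
      if "\<phi> \<in> {0<..<pi}" "t \<in> arc_minus kp km" for \<phi> t
      unfolding norm_mult using M q(2) that by (intro mult_mono) simp_all
    show "set_integrable lborel (arc_plus kp km) (\<lambda>\<phi>. complex_of_real ((cmod (J (\<lambda>t. a \<phi> t * q t)))\<^sup>2))"
    proof (rule integrable)
      show "continuous_on {0<..<pi} (\<lambda>\<phi>. complex_of_real ((cmod (J (\<lambda>t. a \<phi> t * q t)))\<^sup>2) :: complex)"
        by (intro continuous_intros param(1)[OF V V_le])
      show "cmod (complex_of_real ((cmod (J (\<lambda>t. a \<phi> t * q t)))\<^sup>2)) \<le> (M * max B 0 * (pi - 2 * theta_c kp km))\<^sup>2"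
        if "\<phi> \<in> {0<..<pi}" for \<phi>
        unfolding norm_of_real abs_power2 by (intro power_mono param(2)[OF V V_le that]) simp_all
    qed (simp_all add: a_horizontal)
  qed
  have p_family: "continuous_on ({0<..<pi} \<times> arc_minus kp km) (\<lambda>z. cnj (p (snd z)))"
    "\<And>t. t \<in> arc_minus kp km \<Longrightarrow> cmod (cnj (p t)) \<le> max B 0"
    by (intro continuous_on_cnj cont_pair) (simp only: complex_mod_cnj B)
  note ints = quadratic[OF cont_pair(2) B] quadratic[OF p_family]
    linear[OF cont_pair(2) B] linear[OF p_family]
  have "P (\<lambda>\<phi>. J (\<lambda>t2. J (\<lambda>t1. of_real ((cmod (a \<phi> t1 + a \<phi> t2))\<^sup>2) * p t1 * cnj (p t2)))) =
    P (\<lambda>\<phi>. J (\<lambda>t. cnj (p t)) * J (\<lambda>t. of_real ((cmod (a \<phi> t))\<^sup>2) * p t)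
      + J p * J (\<lambda>t. of_real ((cmod (a \<phi> t))\<^sup>2) * cnj (p t))
      + complex_of_real ((cmod (J (\<lambda>t. a \<phi> t * p t)))\<^sup>2) + complex_of_real ((cmod (J (\<lambda>t. a \<phi> t * cnj (p t))))\<^sup>2))"
    unfolding P_def
  proof (intro set_lebesgue_integral_cong allI impI)
    show "arc_plus kp km \<in> sets lborel"
      by (simp add: arc_plus_def)
  qed (rule four_intensity_identity[OF cont_section[unfolded arc_minus_def]
        cont_p[unfolded arc_minus_def], folded arc_minus_def])
  also have "\<dots> = J (\<lambda>t. cnj (p t)) * P (\<lambda>\<phi>. J (\<lambda>t. of_real ((cmod (a \<phi> t))\<^sup>2) * p t))
      + J p * P (\<lambda>\<phi>. J (\<lambda>t. of_real ((cmod (a \<phi> t))\<^sup>2) * cnj (p t)))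
      + P (\<lambda>\<phi>. complex_of_real ((cmod (J (\<lambda>t. a \<phi> t * p t)))\<^sup>2))
      + P (\<lambda>\<phi>. complex_of_real ((cmod (J (\<lambda>t. a \<phi> t * cnj (p t))))\<^sup>2))"
    unfolding P_def using ints
    by (simp only: set_integral_add set_integrable_mult_right set_integral_mult_right)
  finally have "P (\<lambda>\<phi>. J (\<lambda>t2. J (\<lambda>t1. of_real ((cmod (a \<phi> t1 + a \<phi> t2))\<^sup>2) * p t1 * cnj (p t2))))
      - J (\<lambda>t. cnj (p t)) * P (\<lambda>\<phi>. J (\<lambda>t. of_real ((cmod (a \<phi> t))\<^sup>2) * p t))
      - J p * P (\<lambda>\<phi>. J (\<lambda>t. of_real ((cmod (a \<phi> t))\<^sup>2) * cnj (p t)))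
    = P (\<lambda>\<phi>. complex_of_real ((cmod (J (\<lambda>t. a \<phi> t * p t)))\<^sup>2))
      + P (\<lambda>\<phi>. complex_of_real ((cmod (J (\<lambda>t. a \<phi> t * cnj (p t))))\<^sup>2))"
    by simp
  then show ?thesis
    unfolding imaging_function_def u_inf2_def I1_def I2_def v_inf_def w_inf_def cnj_p
      a_def[symmetric] p_def[symmetric] P_def of_real_add set_integral_complex_of_real .
qed

lemma superposed_data_patterns:
  "scattering_solution D kp km (boundary_data_v kp km z) (field (boundary_data_v kp km z))"
  "is_far_field_pattern kp (field (boundary_data_v kp km z)) (v_inf D kp km z)"
  "scattering_solution D kp km (boundary_data_w kp km z) (field (boundary_data_w kp km z))"
  "is_far_field_pattern kp (field (boundary_data_w kp km z)) (w_inf D kp km z)"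
proof -
  have v: "boundary_data_v kp km z x = - J (\<lambda>t. transmitted kp km x t * transmitted kp km (- z) t)" for x
    unfolding boundary_data_v_def transmitted_mult by simp
  have w: "boundary_data_w kp km z x = - J (\<lambda>t. transmitted kp km x t * transmitted kp km z t)" for x
    unfolding boundary_data_w_def transmitted_mult by simp
  note c = continuous_on_transmitted_angle[OF wave_numbers]
  show "scattering_solution D kp km (boundary_data_v kp km z) (field (boundary_data_v kp km z))"
    by (rule superposition(1)[OF c v])
  show "scattering_solution D kp km (boundary_data_w kp km z) (field (boundary_data_w kp km z))"
    by (rule superposition(1)[OF c w])
  show "is_far_field_pattern kp (field (boundary_data_v kp km z)) (v_inf D kp km z)"
    unfolding v_inf_def[abs_def] by (rule superposition(2)[OF c v])
  show "is_far_field_pattern kp (field (boundary_data_w kp km z)) (w_inf D kp km z)"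
    unfolding w_inf_def[abs_def] by (rule superposition(2)[OF c w])
qed

end

section \<open>Decomposition of the imaging function\<close>

theorem theorem2p2:
  fixes D :: "(real ^ 2) set" and kp km :: real
  assumes wave_numbers: "kp > 0" "km > 0" "kp \<noteq> km"
    and obstacle: "open D" "bounded D" "connected (- D)" "finite (components D)"
      "closure D \<subseteq> lower"
    and well_posed: "well_posed D kp km"
    and far_field: "\<And>f u. scattering_solution D kp km f u \<Longrightarrow> \<exists>U. is_far_field_pattern kp u U"
  shows "\<forall>z::real ^ 2.
     imaging_function D kp km z = of_real (I1 D kp km z + I2 D kp km z) \<and>
     (let u = scattered_field D kp km (boundary_data_v kp km z)
      in scattering_solution D kp km (boundary_data_v kp km z) u \<and>
         is_far_field_pattern kp u (v_inf D kp km z)) \<and>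
     (let u = scattered_field D kp km (boundary_data_w kp km z)
      in scattering_solution D kp km (boundary_data_w kp km z) u \<and>
         is_far_field_pattern kp u (w_inf D kp km z))"
proof -
  interpret two_layered_scattering D kp km
    by (rule two_layered_scattering.intro) (fact wave_numbers obstacle well_posed far_field)+
  show ?thesis
    unfolding Let_def
    by (intro allI conjI imaging_function_decomposition superposed_data_patterns)
qed

end
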